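(* Let $\mathcal X$ be a set of variables of arbitrary infinite (possibly uncountable) cardinality $\kappa$, let $\Theta\subseteq\mathsf{FORM}_{\mathcal X}$ and $\psi\in\mathsf{FORM}_{\mathcal X}$. Then $\Theta\models_\partial\psi$ if and only if $\Theta\vdash\psi$.
   Context: $\mathsf{FORM}_{\mathcal X}$ is the set of formulas of infinite-valued Łukasiewicz propositional logic whose (finitely many) variables lie in $\mathcal X$; $\Theta\vdash\psi$ means derivability from $\Theta$ via the Łukasiewicz axioms and Modus Ponens. For a finite $\mathcal H\subseteq\mathcal X$ and a formula $\phi$ with variables in $\mathcal H$, $\hat\phi\colon[0,1]^{\mathcal H}\to[0,1]$ is its truth function (computed with $\neg x=1-x$, $x\oplus y=\min(1,x+y)$); $\mathcal M([0,1]^{\mathcal H})$ denotes the MV-algebra of all such functions (the free MV-algebra on $\mathcal H$), and for $\mathcal H\subseteq\mathcal K$ it is identified with a subalgebra of $\mathcal M([0,1]^{\mathcal K})$ (functions not depending on coordinates outside $\mathcal H$). $\mathrm{var}(\phi)$ is the set of variables occurring in $\phi$. A differential valuation in $\mathbb R^{\mathcal H}$ (with $|\mathcal H|=h$) is, for some $0\le t\le h$, a tuple $U=(u_0,\dots,u_t)$ of vectors in $\mathbb R^{\mathcal H}$ with $u_1,\dots,u_t$ pairwise orthogonal unit vectors, such that for all large integers $m$ the simplex $T_{U,m}=\mathrm{conv}(u_0,\,u_0+u_1/m,\dots,u_0+u_1/m+\cdots+u_t/m^t)$ lies in $[0,1]^{\mathcal H}$; $\mathfrak p_U=\{f\in\mathcal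 M([0,1]^{\mathcal H})\mid f \text{ vanishes on } T_{U,m}\text{ for some } m\}$. For finite $\mathcal H\subseteq\mathcal K\subseteq\mathcal X$ and differential valuations $U$ in $\mathbb R^{\mathcal H}$, $V$ in $\mathbb R^{\mathcal K}$, $V$ dominates $U$ ($V\succeq U$) if $\mathfrak p_U=\mathfrak p_V\cap\mathcal M([0,1]^{\mathcal H})$. A differential valuation in $\mathbb R^\kappa$ is a family $W=\{U_{\mathcal H}\}$, indexed by all finite $\mathcal H\subseteq\mathcal X$, of differential valuations $U_{\mathcal H}$ in $\mathbb R^{\mathcal H}$ such that for all finite $\mathcal H',\mathcal H''$, $U_{\mathcal H'\cup\mathcal H''}$ dominates both $U_{\mathcal H'}$ and $U_{\mathcal H''}$. $W$ satisfies $\phi$ if $1-\hat\phi\in\mathfrak p_{U_{\mathrm{var}(\phi)}}$. $\Theta\models_\partial\psi$ iff every differential valuation in $\mathbb R^\kappa$ satisfying every $\theta\in\Theta$ satisfies $\psi$. *)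

theory Defs
  imports "HOL-Library.FuncSet" "HOL-Analysis.L2_Norm"
begin

text \<open>
  Formulas are built from \<open>\<not>\<close> and \<open>\<rightarrow>\<close>, the connectives in which the Lukasiewicz axioms are
  stated; \<open>\<phi> \<oplus> \<psi>\<close> stands for \<open>\<not>\<phi> \<rightarrow> \<psi>\<close>.
\<close>

datatype (vars: 'x) luk_form =
    Var 'x
  | Neg "'x luk_form"
  | Imp "'x luk_form" "'x luk_form"

definition Oplus :: "'x luk_form \<Rightarrow> 'x luk_form \<Rightarrow> 'x luk_form" where
  "Oplus \<phi> \<psi> = Imp (Neg \<phi>) \<psi>"

definition FORM :: "'x set \<Rightarrow> 'x luk_form set" where
  "FORM X = {\<phi>. vars \<phi> \<subseteq> X}"

inductive luk_axiom :: "'x luk_form \<Rightarrow> bool" where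
  A1: "luk_axiom (Imp \<phi> (Imp \<psi> \<phi>))"
| A2: "luk_axiom (Imp (Imp \<phi> \<psi>) (Imp (Imp \<psi> \<chi>) (Imp \<phi> \<chi>)))"
| A3: "luk_axiom (Imp (Imp (Imp \<phi> \<psi>) \<psi>) (Imp (Imp \<psi> \<phi>) \<phi>))"
| A4: "luk_axiom (Imp (Imp (Neg \<phi>) (Neg \<psi>)) (Imp \<psi> \<phi>))"

inductive luk_derives :: "'x set \<Rightarrow> 'x luk_form set \<Rightarrow> 'x luk_form \<Rightarrow> bool"
  for X :: "'x set" and \<Theta> :: "'x luk_form set" where
  hyp: "\<theta> \<in> \<Theta> \<Longrightarrow> luk_derives X \<Theta> \<theta>"
| ax: "luk_axiom \<phi> \<Longrightarrow> \<phi> \<in> FORM X \<Longrightarrow> luk_derives X \<Theta> \<phi>"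
| mp: "luk_derives X \<Theta> \<phi> \<Longrightarrow> luk_derives X \<Theta> (Imp \<phi> \<psi>) \<Longrightarrow> luk_derives X \<Theta> \<psi>"

definition mv_neg :: "real \<Rightarrow> real" where
  "mv_neg x = 1 - x"

definition mv_oplus :: "real \<Rightarrow> real \<Rightarrow> real" where
  "mv_oplus x y = min 1 (x + y)"

primrec luk_eval :: "('x \<Rightarrow> real) \<Rightarrow> 'x luk_form \<Rightarrow> real" where
  "luk_eval v (Var x) = v x"
| "luk_eval v (Neg \<phi>) = mv_neg (luk_eval v \<phi>)"
| "luk_eval v (Imp \<phi> \<psi>) = mv_oplus (mv_neg (luk_eval v \<phi>)) (luk_eval v \<psi>)"

lemma luk_eval_Oplus: "luk_eval v (Oplus \<phi> \<psi>) = mv_oplus (luk_eval v \<phi>) (luk_eval v \<psi>)"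
  by (simp add: Oplus_def mv_neg_def)

text \<open>
  \<open>\<real>\<^sup>H\<close> is \<open>H \<rightarrow>\<^sub>E UNIV\<close>, the functions with value \<open>undefined\<close> outside \<open>H\<close>; likewise a function on
  the cube is \<open>undefined\<close> outside the cube.
\<close>

definition cube :: "'x set \<Rightarrow> ('x \<Rightarrow> real) set" where
  "cube H = H \<rightarrow>\<^sub>E {0..1}"

definition truth_fun :: "'x set \<Rightarrow> 'x luk_form \<Rightarrow> ('x \<Rightarrow> real) \<Rightarrow> real" where
  "truth_fun H \<phi> = (\<lambda>v\<in>cube H. luk_eval v \<phi>)"

definition McN :: "'x set \<Rightarrow> (('x \<Rightarrow> real) \<Rightarrow> real) set" where
  "McN H = {truth_fun H \<phi> | \<phi>. vars \<phi> \<subseteq> H}"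

text \<open>For \<open>H \<subseteq> K\<close>, this embeds \<open>McN H\<close> into \<open>McN K\<close> as the functions independent of \<open>K - H\<close>.\<close>

definition McN_embed ::
    "'x set \<Rightarrow> 'x set \<Rightarrow> (('x \<Rightarrow> real) \<Rightarrow> real) \<Rightarrow> (('x \<Rightarrow> real) \<Rightarrow> real)" where
  "McN_embed H K f = (\<lambda>v\<in>cube K. f (restrict v H))"

text \<open>
  A tuple \<open>(u\<^sub>0, \<dots>, u\<^sub>t)\<close> is a list \<open>U\<close> of length \<open>t + 1\<close>. For \<open>m > 0\<close>, \<open>dv_simplex H U m\<close> is the
  convex hull of the points \<open>dv_vertex H U m 0, \<dots>, dv_vertex H U m t\<close>.
\<close>

definition dv_vertex :: "'x set \<Rightarrow> ('x \<Rightarrow> real) list \<Rightarrow> nat \<Rightarrow> nat \<Rightarrow> ('x \<Rightarrow> real)" where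
  "dv_vertex H U m i = (\<lambda>x\<in>H. \<Sum>j\<le>i. (U ! j) x / real m ^ j)"

definition dv_simplex :: "'x set \<Rightarrow> ('x \<Rightarrow> real) list \<Rightarrow> nat \<Rightarrow> ('x \<Rightarrow> real) set" where
  "dv_simplex H U m =
     {(\<lambda>x\<in>H. \<Sum>i<length U. c i * dv_vertex H U m i x) | c :: nat \<Rightarrow> real.
        (\<forall>i<length U. c i \<ge> 0) \<and> (\<Sum>i<length U. c i) = 1}"

definition is_diff_val :: "'x set \<Rightarrow> ('x \<Rightarrow> real) list \<Rightarrow> bool" where
  "is_diff_val H U \<longleftrightarrow>
     U \<noteq> [] \<and> length U - 1 \<le> card H \<and> set U \<subseteq> (H \<rightarrow>\<^sub>E UNIV) \<and>
     (\<forall>i\<in>{1..<length U}. L2_set (U ! i) H = 1) \<and>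
     (\<forall>i\<in>{1..<length U}. \<forall>j\<in>{1..<length U}.
        i \<noteq> j \<longrightarrow> (\<Sum>x\<in>H. (U ! i) x * (U ! j) x) = 0) \<and>
     (\<forall>\<^sub>F m in sequentially. dv_simplex H U m \<subseteq> cube H)"

text \<open>
  Only those \<open>m\<close> are meaningful for which the simplex lies in the cube, the domain of \<open>f\<close>.
\<close>

definition dv_ideal :: "'x set \<Rightarrow> ('x \<Rightarrow> real) list \<Rightarrow> (('x \<Rightarrow> real) \<Rightarrow> real) set" where
  "dv_ideal H U =
     {f \<in> McN H. \<exists>m>0. dv_simplex H U m \<subseteq> cube H \<and> (\<forall>v\<in>dv_simplex H U m. f v = 0)}"

text \<open>\<open>V\<close> in \<open>\<real>\<^sup>K\<close> dominates \<open>U\<close> in \<open>\<real>\<^sup>H\<close>.\<close>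

definition dominates ::
    "'x set \<Rightarrow> ('x \<Rightarrow> real) list \<Rightarrow> 'x set \<Rightarrow> ('x \<Rightarrow> real) list \<Rightarrow> bool" where
  "dominates K V H U \<longleftrightarrow>
     McN_embed H K ` dv_ideal H U = dv_ideal K V \<inter> McN_embed H K ` McN H"

text \<open>A differential valuation in \<open>\<real>\<^sup>X\<close>; the values of \<open>W\<close> at other sets are irrelevant.\<close>

definition is_diff_val_family :: "'x set \<Rightarrow> ('x set \<Rightarrow> ('x \<Rightarrow> real) list) \<Rightarrow> bool" where
  "is_diff_val_family X W \<longleftrightarrow>
     (\<forall>H. finite H \<and> H \<subseteq> X \<longrightarrow> is_diff_val H (W H)) \<and>
     (\<forall>H H'. finite H \<and> H \<subseteq> X \<and> finite H' \<and> H' \<subseteq> X \<longrightarrow>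
        dominates (H \<union> H') (W (H \<union> H')) H (W H) \<and>
        dominates (H \<union> H') (W (H \<union> H')) H' (W H'))"

definition dv_satisfies :: "('x set \<Rightarrow> ('x \<Rightarrow> real) list) \<Rightarrow> 'x luk_form \<Rightarrow> bool" where
  "dv_satisfies W \<phi> \<longleftrightarrow>
     (\<lambda>v\<in>cube (vars \<phi>). 1 - truth_fun (vars \<phi>) \<phi> v) \<in> dv_ideal (vars \<phi>) (W (vars \<phi>))"

definition dv_entails :: "'x set \<Rightarrow> 'x luk_form set \<Rightarrow> 'x luk_form \<Rightarrow> bool" where
  "dv_entails X \<Theta> \<psi> \<longleftrightarrow>
     (\<forall>W. is_diff_val_family X W \<longrightarrow> (\<forall>\<theta>\<in>\<Theta>. dv_satisfies W \<theta>) \<longrightarrow> dv_satisfies W \<psi>)"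

end

theory Submission
  imports
    Defs
    "HOL-Library.Function_Algebras"
    "HOL-Library.Landau_Symbols"
    "HOL-Library.Multiset"
    "HOL-Analysis.Elementary_Metric_Spaces"
begin

text \<open>
  Soundness: the simplices of a differential valuation decrease with \<open>m\<close>, so being true on some of
  them is being eventually true for a filter, and hence closed under Modus Ponens; domination
  transports truth between sets of variables.

  Completeness: if \<open>\<psi>\<close> is not derivable, extend \<open>\<Theta>\<close> to a theory \<open>T\<close> without \<open>\<psi>\<close> whose Lindenbaum
  algebra is totally ordered. Addition with carry embeds this chain into a totally ordered abelian
  group (Chang), and Fourier--Motzkin elimination moves the finitely many linear inequalities
  between the values of finitely many formulas from that group to the reals. So for every finite
  \<open>H\<close> there is a sequence of points of the cube such that each formula over \<open>H\<close> is in \<open>T\<close> iff it is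
  true at almost all points of the sequence. The iterated tangent directions (Bouligand--Severi) of
  a subsequence form a differential valuation: an affine function has the same sign at the points
  of the subsequence as, lexicographically, along the tangent directions, so each piecewise linear
  truth function is given by one and the same affine function on late points and on small simplices.
\<close>

section \<open>Theories of Lukasiewicz logic\<close>

abbreviation Join :: "'x luk_form \<Rightarrow> 'x luk_form \<Rightarrow> 'x luk_form" where
  "Join \<phi> \<psi> \<equiv> Imp (Imp \<phi> \<psi>) \<psi>"

definition Top :: "'x luk_form" where
  "Top = Imp (Var undefined) (Var undefined)"

definition Bot :: "'x luk_form" where
  "Bot = Neg Top"

locale luk_theory =
  fixes T :: "'x luk_form set"
  assumes axiom_in: "luk_axiom \<phi> \<Longrightarrow> \<phi> \<in> T"
    and mp: "\<phi> \<in> T \<Longrightarrow> Imp \<phi> \<psi> \<in> T \<Longrightarrow> \<psi> \<in> T"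
begin

abbreviation implies (infix "\<preceq>" 50) where "a \<preceq> b \<equiv> Imp a b \<in> T"

lemma weakening: "a \<preceq> Imp b a"
  by (rule axiom_in) (rule A1)

lemma suffixing: "Imp a b \<preceq> Imp (Imp b c) (Imp a c)"
  by (rule axiom_in) (rule A2)

lemma Join_commute_implies: "Join a b \<preceq> Join b a"
  by (rule axiom_in) (rule A3)

lemma contraposition: "Imp (Neg a) (Neg b) \<preceq> Imp b a"
  by (rule axiom_in) (rule A4)

lemma implies_trans: "a \<preceq> b \<Longrightarrow> b \<preceq> c \<Longrightarrow> a \<preceq> c"
  by (rule mp[OF _ mp[OF _ suffixing]])

lemma Imp_left_antimono: "a \<preceq> b \<Longrightarrow> Imp b c \<preceq> Imp a c"
  by (rule mp[OF _ suffixing])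

lemma implies_member: "t \<in> T \<Longrightarrow> a \<preceq> t"
  by (rule mp[OF _ weakening])

lemma Imp_member_implies: "t \<in> T \<Longrightarrow> Imp t a \<preceq> a"
  by (rule mp[OF mp[OF _ weakening] Join_commute_implies])

lemma implies_refl: "a \<preceq> a"
  by (rule implies_trans[OF weakening Imp_member_implies[OF axiom_in[OF A1]]])

lemma implies_Join: "a \<preceq> Join a b"
  by (rule implies_trans[OF weakening Join_commute_implies])

lemma exchange_rule: "a \<preceq> Imp b c \<Longrightarrow> b \<preceq> Imp a c"
  by (rule implies_trans[OF implies_Join Imp_left_antimono])

lemma prefixing: "Imp b c \<preceq> Imp (Imp a b) (Imp a c)"
  by (rule exchange_rule) (rule suffixing)

lemma Imp_right_mono: "b \<preceq> c \<Longrightarrow> Imp a b \<preceq> Imp a c"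
  by (rule mp[OF _ prefixing])

lemma exchange_implies: "Imp a (Imp b c) \<preceq> Imp b (Imp a c)"
  by (rule implies_trans[OF suffixing Imp_left_antimono[OF implies_Join]])

lemma Join_mp: "Join a y \<in> T \<Longrightarrow> Join (Imp a b) y \<in> T \<Longrightarrow> Join b y \<in> T"
  by (rule implies_trans[OF implies_trans[OF exchange_rule[OF suffixing] Imp_right_mono]])

definition equivalent (infix "\<doteq>" 50) where "a \<doteq> b \<longleftrightarrow> a \<preceq> b \<and> b \<preceq> a"

lemma equivalentI: "a \<preceq> b \<Longrightarrow> b \<preceq> a \<Longrightarrow> a \<doteq> b"
  by (simp add: equivalent_def)

lemma equivalent_refl: "a \<doteq> a"
  by (simp add: equivalentI implies_refl)

lemma equivalent_sym: "a \<doteq> b \<Longrightarrow> b \<doteq> a"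
  by (simp add: equivalent_def)

lemma equivalent_trans [trans]: "a \<doteq> b \<Longrightarrow> b \<doteq> c \<Longrightarrow> a \<doteq> c"
  unfolding equivalent_def by (blast intro: implies_trans)

lemma equivalent_member_iff: "a \<doteq> b \<Longrightarrow> a \<in> T \<longleftrightarrow> b \<in> T"
  unfolding equivalent_def by (blast intro: mp)

lemma Imp_cong: "a \<doteq> a' \<Longrightarrow> b \<doteq> b' \<Longrightarrow> Imp a b \<doteq> Imp a' b'"
  unfolding equivalent_def by (auto intro: implies_trans[OF Imp_left_antimono Imp_right_mono])

lemma exchange: "Imp a (Imp b c) \<doteq> Imp b (Imp a c)"
  by (rule equivalentI) (rule exchange_implies)+

lemma Join_commute: "Join a b \<doteq> Join b a"
  by (rule equivalentI) (rule Join_commute_implies)+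

lemma Top_in: "Top \<in> T"
  by (simp add: Top_def implies_refl)

lemma equivalent_Top_iff: "a \<doteq> Top \<longleftrightarrow> a \<in> T"
  unfolding equivalent_def by (auto intro: mp Top_in implies_member)

lemma Imp_member_left: "t \<in> T \<Longrightarrow> Imp t a \<doteq> a"
  by (simp add: equivalentI weakening Imp_member_implies)

lemma Bot_implies: "Bot \<preceq> a"
  unfolding Bot_def
  by (rule implies_trans[OF weakening
        implies_trans[OF contraposition Imp_member_implies[OF Top_in]]])

lemma Neg_equivalent_Imp_Bot: "Neg a \<doteq> Imp a Bot"
proof (rule equivalentI)
  show "Neg a \<preceq> Imp a Bot"
    unfolding Bot_def by (rule implies_trans[OF weakening contraposition])
  have "Imp (Neg a) Bot \<preceq> a"
    unfolding Bot_def by (rule implies_trans[OF contraposition Imp_member_implies[OF Top_in]])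
  then have "Imp a Bot \<preceq> Join (Neg a) Bot"
    by (rule Imp_left_antimono)
  then show "Imp a Bot \<preceq> Neg a"
    by (rule implies_trans[OF implies_trans[OF _ Join_commute_implies]
          Imp_member_implies[OF Bot_implies]])
qed

lemma Neg_cong: "a \<doteq> b \<Longrightarrow> Neg a \<doteq> Neg b"
  by (rule equivalent_trans[OF Neg_equivalent_Imp_Bot
        equivalent_trans[OF Imp_cong[OF _ equivalent_refl]
          equivalent_sym[OF Neg_equivalent_Imp_Bot]]])

lemma Neg_Neg: "Neg (Neg a) \<doteq> a"
proof -
  have "Neg (Neg a) \<doteq> Join a Bot"
    by (rule equivalent_trans[OF Neg_cong[OF Neg_equivalent_Imp_Bot] Neg_equivalent_Imp_Bot])
  also have "Join a Bot \<doteq> Join Bot a"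
    by (rule Join_commute)
  also have "Join Bot a \<doteq> a"
    by (rule Imp_member_left[OF Bot_implies])
  finally show ?thesis .
qed

lemma Imp_contrapos: "Imp a b \<doteq> Imp (Neg b) (Neg a)"
proof (rule equivalent_sym)
  have "Imp (Neg b) (Neg a) \<doteq> Imp (Neg b) (Imp a Bot)"
    by (simp add: Imp_cong Neg_equivalent_Imp_Bot equivalent_refl)
  also have "Imp (Neg b) (Imp a Bot) \<doteq> Imp a (Imp (Neg b) Bot)"
    by (rule exchange)
  also have "Imp a (Imp (Neg b) Bot) \<doteq> Imp a b"
    by (rule Imp_cong[OF equivalent_refl
          equivalent_trans[OF equivalent_sym[OF Neg_equivalent_Imp_Bot] Neg_Neg]])
  finally show "Imp (Neg b) (Neg a) \<doteq> Imp a b" .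
qed

text \<open>
  With \<open>c = a \<squnion> b\<close>, both \<open>a \<rightarrow> b\<close> and \<open>b \<rightarrow> a\<close> become implications from \<open>c\<close>; contraposition moves \<open>c\<close>
  to the right, where \<open>(\<not>b \<rightarrow> \<not>c) \<rightarrow> \<not>c = \<not>b \<squnion> \<not>c = \<not>b\<close>.
\<close>

lemma prelinearity: "Join (Imp a b) (Imp b a) \<in> T"
proof -
  define c where "c = Join a b"
  have "b \<preceq> c" unfolding c_def by (rule weakening)
  have Imp_a_b: "Imp a b \<doteq> Imp c b"
    unfolding c_def by (simp add: equivalentI Imp_left_antimono implies_Join)
  have Imp_b_a: "Imp b a \<doteq> Imp c a"
  proof (rule equivalentI)
    have "Join (Imp b a) a \<preceq> Imp c a"
      unfolding c_def by (rule Imp_left_antimono) (rule Join_commute_implies)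
    then show "Imp b a \<preceq> Imp c a" by (rule implies_trans[OF implies_Join])
    show "Imp c a \<preceq> Imp b a" using \<open>b \<preceq> c\<close> by (rule Imp_left_antimono)
  qed
  have "Imp (Imp a b) (Imp b a) \<doteq> Imp (Imp (Neg b) (Neg c)) (Imp (Neg a) (Neg c))"
    by (rule Imp_cong[OF equivalent_trans[OF Imp_a_b Imp_contrapos]
          equivalent_trans[OF Imp_b_a Imp_contrapos]])
  also have "\<dots> \<doteq> Imp (Neg a) (Join (Neg b) (Neg c))"
    by (rule exchange)
  also have "\<dots> \<doteq> Imp (Neg a) (Join (Neg c) (Neg b))"
    by (intro Imp_cong equivalent_refl Join_commute)
  also have "\<dots> \<doteq> Imp (Neg a) (Neg b)"
    using \<open>b \<preceq> c\<close> equivalent_member_iff[OF Imp_contrapos]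
    by (intro Imp_cong equivalent_refl Imp_member_left) blast
  also have "\<dots> \<doteq> Imp b a"
    by (rule equivalent_sym[OF Imp_contrapos])
  finally show ?thesis by (simp add: equivalent_def)
qed

end

definition luk_closure :: "'x luk_form set \<Rightarrow> 'x luk_form set" where
  "luk_closure \<Theta> = {\<phi>. luk_derives UNIV \<Theta> \<phi>}"

lemma luk_theory_closure: "luk_theory (luk_closure \<Theta>)"
  by standard (auto simp: luk_closure_def FORM_def intro: luk_derives.intros)

lemma subset_luk_closure: "\<Theta> \<subseteq> luk_closure \<Theta>"
  by (auto simp: luk_closure_def intro: luk_derives.hyp)

lemma (in luk_theory) luk_closure_subset:
  assumes "\<Theta> \<subseteq> T"
  shows "luk_closure \<Theta> \<subseteq> T"
proof
  fix \<phi> assume "\<phi> \<in> luk_closure \<Theta>"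
  then have "luk_derives UNIV \<Theta> \<phi>" by (simp add: luk_closure_def)
  then show "\<phi> \<in> T"
    using assms by (induction rule: luk_derives.induct) (auto intro: axiom_in mp)
qed

lemma (in luk_theory) luk_theory_Join: "luk_theory {\<eta>. Join \<eta> y \<in> T}"
  by standard (auto intro: Join_mp Imp_member_implies axiom_in)

lemma (in luk_theory) proof_by_cases:
  assumes "Join x y \<in> T"
    and "\<psi> \<in> luk_closure (insert x T)" and "\<psi> \<in> luk_closure (insert y T)"
  shows "\<psi> \<in> T"
proof -
  have "luk_closure (insert x T) \<subseteq> {\<eta>. Join \<eta> y \<in> T}"
    using assms(1) by (intro luk_theory.luk_closure_subset[OF luk_theory_Join])
      (auto intro: Imp_member_implies)
  with assms(2) have "Join y \<psi> \<in> T" by (auto intro: mp Join_commute_implies)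
  then have "luk_closure (insert y T) \<subseteq> {\<eta>. Join \<eta> \<psi> \<in> T}"
    by (intro luk_theory.luk_closure_subset[OF luk_theory_Join]) (auto intro: Imp_member_implies)
  with assms(3) show ?thesis by (auto intro: mp implies_refl)
qed

lemma luk_theory_Union_chain:
  assumes "C \<noteq> {}" and "subset.chain {T. luk_theory T} C"
  shows "luk_theory (\<Union>C)"
proof
  have is_theory: "luk_theory T" if "T \<in> C" for T
    using assms(2) that by (auto simp: subset_chain_def)
  show "\<phi> \<in> \<Union>C" if "luk_axiom \<phi>" for \<phi>
    using that assms(1) is_theory luk_theory.axiom_in by blast
  show "\<psi> \<in> \<Union>C" if "\<phi> \<in> \<Union>C" "Imp \<phi> \<psi> \<in> \<Union>C" for \<phi> \<psi>
  proof -
    from that obtain A B where "A \<in> C" "\<phi> \<in> A" "B \<in> C" "Imp \<phi> \<psi> \<in> B" by blast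
    moreover from this have "A \<subseteq> B \<or> B \<subseteq> A"
      using assms(2) by (simp add: subset_chain_def)
    ultimately show ?thesis using is_theory luk_theory.mp by blast
  qed
qed

lemma ex_maximal_theory_avoiding:
  assumes "\<psi> \<notin> luk_closure \<Theta>"
  obtains T where "luk_theory T" "\<Theta> \<subseteq> T" "\<psi> \<notin> T"
    and "\<And>x. x \<notin> T \<Longrightarrow> \<psi> \<in> luk_closure (insert x T)"
proof -
  define \<T> where "\<T> = {T. luk_theory T \<and> \<Theta> \<subseteq> T \<and> \<psi> \<notin> T}"
  have closure_in: "luk_closure S \<in> \<T>" if "\<Theta> \<subseteq> S" "\<psi> \<notin> luk_closure S" for S
    using that subset_luk_closure luk_theory_closure unfolding \<T>_def by blast
  then have "\<T> \<noteq> {}" using assms by blast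
  moreover have "\<Union>C \<in> \<T>" if "C \<noteq> {}" "subset.chain \<T> C" for C
  proof -
    have "subset.chain {T. luk_theory T} C"
      using that(2) by (auto simp: \<T>_def subset_chain_def)
    then show ?thesis
      using that luk_theory_Union_chain[of C] by (auto simp: \<T>_def subset_chain_def)
  qed
  ultimately obtain T where "T \<in> \<T>" and maximal: "\<And>S. S \<in> \<T> \<Longrightarrow> T \<subseteq> S \<Longrightarrow> S = T"
    using subset_Zorn_nonempty[of \<T>] by metis
  show thesis
  proof (rule that)
    show "luk_theory T" "\<Theta> \<subseteq> T" "\<psi> \<notin> T" using \<open>T \<in> \<T>\<close> by (simp_all add: \<T>_def)
    fix x assume "x \<notin> T"
    show "\<psi> \<in> luk_closure (insert x T)"
    proof (rule ccontr)
      assume "\<psi> \<notin> luk_closure (insert x T)"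
      with \<open>\<Theta> \<subseteq> T\<close> have "luk_closure (insert x T) \<in> \<T>" by (intro closure_in) auto
      then have "luk_closure (insert x T) = T" using subset_luk_closure by (intro maximal) blast+
      with \<open>x \<notin> T\<close> show False using subset_luk_closure[of "insert x T"] by blast
    qed
  qed
qed

locale prime_theory = luk_theory +
  assumes linear: "Imp a b \<in> T \<or> Imp b a \<in> T"
    and proper: "T \<noteq> UNIV"

theorem prime_theory_exists:
  assumes "\<psi> \<notin> luk_closure \<Theta>"
  obtains T where "prime_theory T" "\<Theta> \<subseteq> T" "\<psi> \<notin> T"
proof -
  obtain T where T_theory: "luk_theory T" "\<Theta> \<subseteq> T" "\<psi> \<notin> T"
    and maximal: "\<And>x. x \<notin> T \<Longrightarrow> \<psi> \<in> luk_closure (insert x T)"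
    using ex_maximal_theory_avoiding[OF assms] by blast
  interpret luk_theory T by (rule T_theory(1))
  have "Imp a b \<in> T \<or> Imp b a \<in> T" for a b
    using proof_by_cases[OF prelinearity] maximal T_theory(3) by blast
  then have "prime_theory T" using T_theory(3) by unfold_locales auto
  with T_theory that show thesis by blast
qed

lemma luk_axiom_subst: "luk_axiom \<phi> \<Longrightarrow> luk_axiom (map_luk_form s \<phi>)"
  by (induction rule: luk_axiom.induct) (auto intro: luk_axiom.intros)

lemma luk_derives_subst:
  assumes "luk_derives X \<Theta> \<phi>"
  shows "luk_derives (s ` X) (map_luk_form s ` \<Theta>) (map_luk_form s \<phi>)"
  using assms
proof (induction rule: luk_derives.induct)
  case (ax \<phi>)
  then show ?case
    by (intro luk_derives.ax luk_axiom_subst) (auto simp: FORM_def luk_form.set_map)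
qed (auto intro: luk_derives.intros)

lemma luk_derives_conservative:
  assumes "luk_derives UNIV \<Theta> \<psi>" and "\<Theta> \<subseteq> FORM X" and "\<psi> \<in> FORM X" and "X \<noteq> {}"
  shows "luk_derives X \<Theta> \<psi>"
proof -
  obtain x0 where "x0 \<in> X" using assms(4) by blast
  define s where "s x = (if x \<in> X then x else x0)" for x
  have fixed: "map_luk_form s \<phi> = \<phi>" if "\<phi> \<in> FORM X" for \<phi>
    using that by (intro luk_form.map_ident_strong) (auto simp: FORM_def s_def)
  then have "map_luk_form s ` \<Theta> = id ` \<Theta>"
    using assms(2) by (intro image_cong) auto
  moreover have "range s = X" using \<open>x0 \<in> X\<close> by (auto simp: s_def)
  ultimately show ?thesis using luk_derives_subst[OF assms(1), of s] fixed[OF assms(3)] by simp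
qed

section \<open>Fourier--Motzkin elimination\<close>

text \<open>With \<open>P\<close> read as \<open>\<ge> 0\<close>, this is \<open>x > 0\<close> for a strict and \<open>x \<ge> 0\<close> for a weak inequality.\<close>

definition cone_ineq :: "('b::uminus \<Rightarrow> bool) \<Rightarrow> bool \<Rightarrow> 'b \<Rightarrow> bool" where
  "cone_ineq P strict x \<longleftrightarrow> P x \<and> (strict \<longrightarrow> \<not> P (- x))"

abbreviation real_ineq :: "bool \<Rightarrow> real \<Rightarrow> bool" where
  "real_ineq \<equiv> cone_ineq ((\<le>) 0)"

lemma real_ineq_iff: "real_ineq strict x \<longleftrightarrow> (if strict then 0 < x else 0 \<le> x)"
  by (auto simp: cone_ineq_def)

lemma real_ineq_mult_iff: "c > 0 \<Longrightarrow> real_ineq strict (c * x) \<longleftrightarrow> real_ineq strict x"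
  by (simp add: real_ineq_iff zero_less_mult_iff zero_le_mult_iff)

locale additive_cone =
  fixes P :: "'b::ab_group_add \<Rightarrow> bool"
  assumes add_closed: "P x \<Longrightarrow> P y \<Longrightarrow> P (x + y)"
begin

lemma cone_ineq_add:
  assumes "cone_ineq P s x" and "cone_ineq P t y"
  shows "cone_ineq P (s \<or> t) (x + y)"
proof -
  have "P (- x)" "P (- y)" if "P (- (x + y))"
    using add_closed[OF that, of x] add_closed[OF that, of y] assms by (simp_all add: cone_ineq_def)
  then show ?thesis using assms add_closed by (auto simp: cone_ineq_def)
qed

end

lemma cone_ineq_scale:
  fixes P :: "('a \<Rightarrow> int) \<Rightarrow> bool"
  assumes "additive_cone P" and "cone_ineq P s f" and "k > 0"
  shows "cone_ineq P s (\<lambda>x. k * f x)"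
  using assms(3)
proof (induction k rule: int_gr_induct)
  case base
  with assms(2) show ?case by simp
next
  case (step k)
  have "(\<lambda>x. (k + 1) * f x) = (\<lambda>x. k * f x) + f"
    by (simp add: fun_eq_iff algebra_simps)
  then show ?case
    using additive_cone.cone_ineq_add[OF assms(1) step.IH assms(2)] by simp
qed

definition eliminate :: "'a \<Rightarrow> ('a \<Rightarrow> int) \<Rightarrow> ('a \<Rightarrow> int) \<Rightarrow> 'a \<Rightarrow> int" where
  "eliminate y f g = (\<lambda>x. - g y * f x + f y * g x)"

definition linear_form :: "'a set \<Rightarrow> ('a \<Rightarrow> real) \<Rightarrow> ('a \<Rightarrow> int) \<Rightarrow> real" where
  "linear_form F w f = (\<Sum>x\<in>F. w x * of_int (f x))"

lemma cone_ineq_eliminate: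
  fixes P :: "('a \<Rightarrow> int) \<Rightarrow> bool"
  assumes "additive_cone P" and "cone_ineq P s f" and "cone_ineq P t g" and "f y > 0" and "g y < 0"
  shows "cone_ineq P (s \<or> t) (eliminate y f g)"
proof -
  have "cone_ineq P s (\<lambda>x. - g y * f x)" "cone_ineq P t (\<lambda>x. f y * g x)"
    using cone_ineq_scale[OF assms(1,2), of "- g y"] cone_ineq_scale[OF assms(1,3), of "f y"]
      assms(4,5) by simp_all
  from additive_cone.cone_ineq_add[OF assms(1) this] show ?thesis
    by (simp add: eliminate_def plus_fun_def)
qed

lemma linear_form_eliminate:
  "linear_form F w (eliminate y f g) =
     - of_int (g y) * linear_form F w f + of_int (f y) * linear_form F w g"
  unfolding linear_form_def eliminate_def sum_distrib_left sum.distrib[symmetric]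
  by (intro sum.cong) (auto simp: algebra_simps)

lemma linear_form_insert:
  assumes "finite F" and "y \<notin> F"
  shows "linear_form (insert y F) (w(y := t)) f = t * of_int (f y) + linear_form F w f"
proof -
  have "(\<Sum>x\<in>F. (w(y := t)) x * of_int (f x)) = (\<Sum>x\<in>F. w x * of_int (f x))"
    using assms(2) by (intro sum.cong) auto
  then show ?thesis using assms by (simp add: linear_form_def)
qed

text \<open>The flag of a bound says whether it is strict.\<close>

lemma ex_between:
  fixes L U :: "(real \<times> bool) set"
  assumes "finite L" and "finite U"
    and separated: "\<And>a s b t. (a, s) \<in> L \<Longrightarrow> (b, t) \<in> U \<Longrightarrow> real_ineq (s \<or> t) (b - a)"
  shows "\<exists>x. (\<forall>(a, s)\<in>L. real_ineq s (x - a)) \<and> (\<forall>(b, t)\<in>U. real_ineq t (b - x))"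
proof -
  define l where "l = Max (fst ` L)"
  define u where "u = Min (fst ` U)"
  have lower_le: "a \<le> l" if "(a, s) \<in> L" for a s
    unfolding l_def using assms(1) that by (force intro: Max_ge)
  have upper_ge: "u \<le> b" if "(b, t) \<in> U" for b t
    unfolding u_def using assms(2) that by (force intro: Min_le)
  consider "L = {}" | "U = {}" | "L \<noteq> {}" "U \<noteq> {}" by blast
  then show ?thesis
  proof cases
    assume "L = {}"
    then show ?thesis using upper_ge by (intro exI[of _ "u - 1"]) (fastforce simp: real_ineq_iff)
  next
    assume "U = {}"
    then show ?thesis using lower_le by (intro exI[of _ "l + 1"]) (fastforce simp: real_ineq_iff)
  next
    assume "L \<noteq> {}" "U \<noteq> {}"
    then have "l \<in> fst ` L" "u \<in> fst ` U"
      unfolding l_def u_def using assms by (auto intro: Max_in Min_in)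
    then obtain p q where "(l, p) \<in> L" "(u, q) \<in> U" by force
    have "real_ineq s ((l + u) / 2 - a)" if "(a, s) \<in> L" for a s
      using lower_le[OF that] separated[OF that \<open>(u, q) \<in> U\<close>]
        separated[OF \<open>(l, p) \<in> L\<close> \<open>(u, q) \<in> U\<close>]
      by (auto simp: real_ineq_iff split: if_splits)
    moreover have "real_ineq t (b - (l + u) / 2)" if "(b, t) \<in> U" for b t
      using upper_ge[OF that] separated[OF \<open>(l, p) \<in> L\<close> that]
        separated[OF \<open>(l, p) \<in> L\<close> \<open>(u, q) \<in> U\<close>]
      by (auto simp: real_ineq_iff split: if_splits)
    ultimately show ?thesis by blast
  qed
qed

definition eliminated :: "'a \<Rightarrow> (('a \<Rightarrow> int) \<times> bool) set \<Rightarrow> (('a \<Rightarrow> int) \<times> bool) set" where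
  "eliminated y C = {(f, s) \<in> C. f y = 0} \<union>
     (\<lambda>((f, s), (g, t)). (eliminate y f g, s \<or> t)) `
       ({(f, s) \<in> C. f y > 0} \<times> {(g, t) \<in> C. g y < 0})"

lemma finite_eliminated: "finite C \<Longrightarrow> finite (eliminated y C)"
  unfolding eliminated_def by (intro finite_UnI finite_imageI finite_cartesian_product)
    (auto intro: finite_subset[of _ C])

lemma eliminated_cases:
  assumes "(h, p) \<in> eliminated y C"
  obtains (kept) "(h, p) \<in> C" "h y = 0"
  | (combined) f s g t where "h = eliminate y f g" "p = (s \<or> t)"
      "(f, s) \<in> C" "f y > 0" "(g, t) \<in> C" "g y < 0"
  using assms unfolding eliminated_def by auto

definition threshold :: "'a set \<Rightarrow> ('a \<Rightarrow> real) \<Rightarrow> 'a \<Rightarrow> ('a \<Rightarrow> int) \<Rightarrow> real" where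
  "threshold F w y f = - linear_form F w f / of_int (f y)"

lemma real_ineq_linear_form_insert_iff:
  assumes "finite F" and "y \<notin> F"
  shows "f y > 0 \<Longrightarrow>
      real_ineq s (linear_form (insert y F) (w(y := t)) f) \<longleftrightarrow> real_ineq s (t - threshold F w y f)"
    and "f y < 0 \<Longrightarrow>
      real_ineq s (linear_form (insert y F) (w(y := t)) f) \<longleftrightarrow> real_ineq s (threshold F w y f - t)"
proof -
  show "real_ineq s (linear_form (insert y F) (w(y := t)) f) \<longleftrightarrow> real_ineq s (t - threshold F w y f)"
    if "f y > 0"
  proof -
    have "linear_form (insert y F) (w(y := t)) f = of_int (f y) * (t - threshold F w y f)"
      using that by (simp add: linear_form_insert[OF assms] threshold_def field_simps)
    then show ?thesis using that by (simp add: real_ineq_mult_iff)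
  qed
  show "real_ineq s (linear_form (insert y F) (w(y := t)) f) \<longleftrightarrow> real_ineq s (threshold F w y f - t)"
    if "f y < 0"
  proof -
    have "linear_form (insert y F) (w(y := t)) f = of_int (- f y) * (threshold F w y f - t)"
      using that by (simp add: linear_form_insert[OF assms] threshold_def field_simps)
    then show ?thesis
      using that real_ineq_mult_iff[of "of_int (- f y)" s "threshold F w y f - t"] by simp
  qed
qed

lemma real_ineq_eliminate_iff:
  assumes "f y > 0" and "g y < 0"
  shows "real_ineq s (linear_form F w (eliminate y f g)) \<longleftrightarrow>
    real_ineq s (threshold F w y g - threshold F w y f)"
proof -
  have "linear_form F w (eliminate y f g) =
      of_int (f y * - g y) * (threshold F w y g - threshold F w y f)"
    using assms by (simp add: linear_form_eliminate threshold_def field_simps)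
  then show ?thesis
    using assms real_ineq_mult_iff[of "of_int (f y * - g y)"] by (simp add: mult_pos_neg)
qed

lemma back_substitution:
  assumes "finite F" and "y \<notin> F" and "finite C"
    and solution: "\<And>f s. (f, s) \<in> eliminated y C \<Longrightarrow> real_ineq s (linear_form F w f)"
  shows "\<exists>t. \<forall>(f, s)\<in>C. real_ineq s (linear_form (insert y F) (w(y := t)) f)"
proof -
  define L where "L = (\<lambda>(f, s). (threshold F w y f, s)) ` {(f, s) \<in> C. f y > 0}"
  define U where "U = (\<lambda>(f, s). (threshold F w y f, s)) ` {(f, s) \<in> C. f y < 0}"
  have "real_ineq (s \<or> t) (threshold F w y g - threshold F w y f)"
    if "(f, s) \<in> C" "f y > 0" "(g, t) \<in> C" "g y < 0" for f s g t
  proof -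
    have "(eliminate y f g, s \<or> t) \<in> eliminated y C"
      using that unfolding eliminated_def by (auto intro!: image_eqI[of _ _ "((f, s), (g, t))"])
    from solution[OF this] show ?thesis using that by (simp add: real_ineq_eliminate_iff)
  qed
  moreover have "finite L" "finite U"
    unfolding L_def U_def using assms(3)
    by (auto intro!: finite_imageI intro: finite_subset[of _ C])
  ultimately have "\<exists>t. (\<forall>(a, s)\<in>L. real_ineq s (t - a)) \<and> (\<forall>(b, s)\<in>U. real_ineq s (b - t))"
    by (intro ex_between) (auto simp: L_def U_def)
  then obtain t where lower: "(f, s) \<in> C \<Longrightarrow> f y > 0 \<Longrightarrow> real_ineq s (t - threshold F w y f)"
    and upper: "(f, s) \<in> C \<Longrightarrow> f y < 0 \<Longrightarrow> real_ineq s (threshold F w y f - t)" for f s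
    unfolding L_def U_def by fast
  have "real_ineq s (linear_form (insert y F) (w(y := t)) f)" if "(f, s) \<in> C" for f s
  proof (cases "f y" "0 :: int" rule: linorder_cases)
    case less
    then show ?thesis
      using upper[OF that] by (simp add: real_ineq_linear_form_insert_iff[OF assms(1,2)])
  next
    case equal
    then have "(f, s) \<in> eliminated y C" using that by (simp add: eliminated_def)
    from solution[OF this] equal show ?thesis by (simp add: linear_form_insert[OF assms(1,2)])
  next
    case greater
    then show ?thesis
      using lower[OF that] by (simp add: real_ineq_linear_form_insert_iff[OF assms(1,2)])
  qed
  then show ?thesis by blast
qed

lemma cone_ineq_eliminated:
  fixes P :: "('a \<Rightarrow> int) \<Rightarrow> bool"
  assumes "additive_cone P" and "\<And>f s. (f, s) \<in> C \<Longrightarrow> cone_ineq P s f" and "(h, p) \<in> eliminated y C"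
  shows "cone_ineq P p h"
  using assms(3) by (cases rule: eliminated_cases)
    (auto intro: assms(2) cone_ineq_eliminate[OF assms(1)])

lemma eliminated_support:
  assumes support: "\<And>f s x. (f, s) \<in> C \<Longrightarrow> x \<notin> insert y F \<Longrightarrow> f x = 0"
    and "(h, p) \<in> eliminated y C" and "x \<notin> F"
  shows "h x = 0"
  using assms(2)
proof (cases rule: eliminated_cases)
  case kept
  then show ?thesis using support[of h p x] assms(3) by (cases "x = y") simp_all
next
  case (combined f s g t)
  then show ?thesis
    using support[of f s x] support[of g t x] assms(3)
    by (cases "x = y") (simp_all add: eliminate_def)
qed

theorem fourier_motzkin:
  fixes P :: "('a \<Rightarrow> int) \<Rightarrow> bool" and C :: "(('a \<Rightarrow> int) \<times> bool) set"
  assumes "additive_cone P" and "finite F" and "finite C"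
    and "\<And>f s. (f, s) \<in> C \<Longrightarrow> cone_ineq P s f"
    and "\<And>f s x. (f, s) \<in> C \<Longrightarrow> x \<notin> F \<Longrightarrow> f x = 0"
  shows "\<exists>w. \<forall>(f, s)\<in>C. real_ineq s (linear_form F w f)"
  using assms(2-)
proof (induction F arbitrary: C rule: finite_induct)
  case empty
  have "\<not> s" if "(f, s) \<in> C" for f s
  proof
    have "- f = f" using empty.prems(3)[OF that] by (simp add: fun_eq_iff)
    moreover assume s
    ultimately show False using empty.prems(2)[OF that] unfolding cone_ineq_def by metis
  qed
  then show ?case by (auto simp: real_ineq_iff linear_form_def)
next
  case (insert y F)
  have "\<exists>w. \<forall>(f, s)\<in>eliminated y C. real_ineq s (linear_form F w f)"
  proof (rule insert.IH)
    show "finite (eliminated y C)" using insert.prems(1) by (rule finite_eliminated)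
    show "cone_ineq P p h" if "(h, p) \<in> eliminated y C" for h p
      using assms(1) insert.prems(2) that by (rule cone_ineq_eliminated)
    show "h x = 0" if "(h, p) \<in> eliminated y C" "x \<notin> F" for h p x
      using insert.prems(3) that by (rule eliminated_support)
  qed
  then obtain w where "\<And>f s. (f, s) \<in> eliminated y C \<Longrightarrow> real_ineq s (linear_form F w f)"
    by blast
  from back_substitution[OF insert.hyps insert.prems(1) this] show ?case by blast
qed

section \<open>Real weights for preorders on multisets\<close>

locale multiset_preorder =
  fixes le :: "'a multiset \<Rightarrow> 'a multiset \<Rightarrow> bool" (infix "\<unlhd>" 50)
  assumes le_trans: "K \<unlhd> M \<Longrightarrow> M \<unlhd> N \<Longrightarrow> K \<unlhd> N"
    and le_total: "M \<unlhd> N \<or> N \<unlhd> M"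
    and add_le_cancel: "K + M \<unlhd> K + N \<longleftrightarrow> M \<unlhd> N"
begin

definition count_diff :: "'a multiset \<Rightarrow> 'a multiset \<Rightarrow> 'a \<Rightarrow> int" where
  "count_diff M N x = int (count N x) - int (count M x)"

definition nonneg :: "('a \<Rightarrow> int) \<Rightarrow> bool" where
  "nonneg f \<longleftrightarrow> (\<exists>M N. M \<unlhd> N \<and> f = count_diff M N)"

lemma add_le_mono: "M \<unlhd> N \<Longrightarrow> M' \<unlhd> N' \<Longrightarrow> M + M' \<unlhd> N + N'"
  by (metis add_le_cancel le_trans union_commute)

lemma nonneg_count_diff_iff: "nonneg (count_diff M N) \<longleftrightarrow> M \<unlhd> N"
proof
  assume "nonneg (count_diff M N)"
  then obtain M' N' where "M' \<unlhd> N'" and count_diff_eq: "count_diff M N = count_diff M' N'"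
    by (auto simp: nonneg_def)
  have "count (M + N') x = count (M' + N) x" for x
    using fun_cong[OF count_diff_eq, of x] by (simp add: count_diff_def)
  then have "M + N' = M' + N" by (rule multiset_eqI)
  moreover have "M + M' \<unlhd> M + N'" using \<open>M' \<unlhd> N'\<close> by (simp add: add_le_cancel)
  ultimately show "M \<unlhd> N" using add_le_cancel[of M' M N] by (simp add: union_commute)
qed (auto simp: nonneg_def)

lemma additive_cone_nonneg: "additive_cone nonneg"
proof
  fix f g assume "nonneg f" "nonneg g"
  then obtain M N M' N'
    where "M \<unlhd> N" "f = count_diff M N" "M' \<unlhd> N'" "g = count_diff M' N'"
    by (auto simp: nonneg_def)
  then have "M + M' \<unlhd> N + N'" "f + g = count_diff (M + M') (N + N')"
    by (simp_all add: add_le_mono count_diff_def fun_eq_iff)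
  then show "nonneg (f + g)" by (auto simp: nonneg_def)
qed

lemma cone_ineq_count_diff_iff:
  "cone_ineq nonneg s (count_diff M N) \<longleftrightarrow> M \<unlhd> N \<and> (s \<longrightarrow> \<not> N \<unlhd> M)"
proof -
  have "- count_diff M N = count_diff N M" by (simp add: count_diff_def fun_eq_iff)
  then show ?thesis by (simp add: cone_ineq_def nonneg_count_diff_iff)
qed

lemma linear_form_count_diff:
  assumes "finite F" and "set_mset M \<subseteq> F" and "set_mset N \<subseteq> F"
  shows "linear_form F w (count_diff M N) = (\<Sum>x\<in>#N. w x) - (\<Sum>x\<in>#M. w x)"
proof -
  have "(\<Sum>x\<in>#K. w x) = (\<Sum>x\<in>F. w x * real (count K x))" if "set_mset K \<subseteq> F" for K
    using that
  proof (induction K)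
    case (add a K)
    have "(\<Sum>x\<in>F. w x * real (count (add_mset a K) x)) =
        (\<Sum>x\<in>F. w x * real (count K x) + (if x = a then w x else 0))"
      by (intro sum.cong) (auto simp: algebra_simps)
    then show ?case using add assms(1) by (simp add: sum.distrib)
  qed simp
  then show ?thesis
    using assms by (simp add: linear_form_def count_diff_def right_diff_distrib sum_subtractf)
qed

theorem ex_real_weights:
  assumes "finite B"
  obtains w :: "'a \<Rightarrow> real"
  where "\<And>M N. M \<in> B \<Longrightarrow> N \<in> B \<Longrightarrow> M \<unlhd> N \<longleftrightarrow> (\<Sum>x\<in>#M. w x) \<le> (\<Sum>x\<in>#N. w x)"
proof -
  define F where "F = (\<Union>M\<in>B. set_mset M)"
  define C where "C = (\<lambda>(M, N). (count_diff M N, \<not> N \<unlhd> M)) ` {(M, N) \<in> B \<times> B. M \<unlhd> N}"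
  have "finite {(M, N) \<in> B \<times> B. M \<unlhd> N}"
    using assms by (auto intro: finite_subset[of _ "B \<times> B"])
  have "\<exists>w. \<forall>(f, s)\<in>C. real_ineq s (linear_form F w f)"
  proof (rule fourier_motzkin[OF additive_cone_nonneg])
    show "finite F" "finite C"
      using assms \<open>finite {(M, N) \<in> B \<times> B. M \<unlhd> N}\<close> by (auto simp: F_def C_def)
    show "cone_ineq nonneg s f" if "(f, s) \<in> C" for f s
      using that by (auto simp: C_def cone_ineq_count_diff_iff)
    show "f x = 0" if "(f, s) \<in> C" "x \<notin> F" for f s x
      using that by (auto simp: C_def F_def count_diff_def not_in_iff)
  qed
  then obtain w where w_ineq: "\<And>f s. (f, s) \<in> C \<Longrightarrow> real_ineq s (linear_form F w f)" by blast
  have w_diff: "real_ineq (\<not> N \<unlhd> M) ((\<Sum>x\<in>#N. w x) - (\<Sum>x\<in>#M. w x))"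
    if "M \<in> B" "N \<in> B" "M \<unlhd> N" for M N
  proof -
    have "(count_diff M N, \<not> N \<unlhd> M) \<in> C" using that by (auto simp: C_def)
    moreover have "finite F" "set_mset M \<subseteq> F" "set_mset N \<subseteq> F"
      using that assms by (auto simp: F_def)
    ultimately show ?thesis using w_ineq linear_form_count_diff by metis
  qed
  have "M \<unlhd> N \<longleftrightarrow> (\<Sum>x\<in>#M. w x) \<le> (\<Sum>x\<in>#N. w x)" if "M \<in> B" "N \<in> B" for M N
    using w_diff[OF that] w_diff[OF that(2,1)] le_total[of M N]
    by (auto simp: real_ineq_iff split: if_splits)
  then show thesis by (rule that)
qed

end

section \<open>Totally ordered MV-algebras\<close>

text \<open>
  The elements of the algebra are the classes of \<open>repr a = repr b\<close>, with \<open>repr\<close> choosing one member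
  of each class: a quotient by a relation that depends on a parameter cannot be a type.
\<close>

locale mv_chain =
  fixes repr :: "'a \<Rightarrow> 'a" and neg :: "'a \<Rightarrow> 'a" and plus :: "'a \<Rightarrow> 'a \<Rightarrow> 'a" (infixl "\<boxplus>" 65)
    and zero :: 'a ("\<zero>")
  assumes plus_commute: "a \<boxplus> b = b \<boxplus> a"
    and plus_assoc: "(a \<boxplus> b) \<boxplus> c = a \<boxplus> (b \<boxplus> c)"
    and plus_zero [simp]: "a \<boxplus> \<zero> = repr a"
    and repr_plus_left [simp]: "repr a \<boxplus> b = a \<boxplus> b"
    and repr_zero [simp]: "repr \<zero> = \<zero>"
    and neg_repr [simp]: "neg (repr a) = neg a"
    and repr_neg [simp]: "repr (neg a) = neg a"
    and neg_neg [simp]: "neg (neg a) = repr a"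
    and plus_one [simp]: "a \<boxplus> neg \<zero> = neg \<zero>"
    and join_commute: "neg (neg a \<boxplus> b) \<boxplus> b = neg (neg b \<boxplus> a) \<boxplus> a"
    and total: "neg a \<boxplus> b = neg \<zero> \<or> neg b \<boxplus> a = neg \<zero>"
    and nontrivial: "neg \<zero> \<noteq> \<zero>"
begin

abbreviation one ("\<one>") where "\<one> \<equiv> neg \<zero>"

definition below (infix "\<sqsubseteq>" 50) where "a \<sqsubseteq> b \<longleftrightarrow> neg a \<boxplus> b = \<one>"

definition prod (infixl "\<boxdot>" 70) where "a \<boxdot> b = neg (neg a \<boxplus> neg b)"

lemma plus_left_commute: "a \<boxplus> (b \<boxplus> c) = b \<boxplus> (a \<boxplus> c)"
  by (metis plus_assoc plus_commute)

lemmas plus_ac = plus_assoc plus_commute plus_left_commute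

lemma zero_plus [simp]: "\<zero> \<boxplus> a = repr a"
  by (simp add: plus_commute[of \<zero>])

lemma one_plus [simp]: "\<one> \<boxplus> a = \<one>"
  by (simp add: plus_commute[of \<one>])

lemma repr_plus_right [simp]: "a \<boxplus> repr b = a \<boxplus> b"
  by (simp add: plus_commute[of a])

lemma repr_plus [simp]: "repr (a \<boxplus> b) = a \<boxplus> b"
  by (metis plus_assoc repr_plus_right plus_zero)

lemma repr_repr [simp]: "repr (repr a) = repr a"
  using repr_neg[of "neg a"] by simp

lemma neg_plus_self [simp]: "neg a \<boxplus> a = \<one>" "a \<boxplus> neg a = \<one>"
  using join_commute[of \<one> a] by (simp_all add: plus_commute[of a])

lemma below_refl: "a \<sqsubseteq> a"
  by (simp add: below_def)

lemma below_repr [simp]: "repr a \<sqsubseteq> b \<longleftrightarrow> a \<sqsubseteq> b" "a \<sqsubseteq> repr b \<longleftrightarrow> a \<sqsubseteq> b"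
  by (simp_all add: below_def)

lemma below_antisym: "a \<sqsubseteq> b \<Longrightarrow> b \<sqsubseteq> a \<Longrightarrow> repr a = repr b"
  using join_commute[of a b] by (simp add: below_def)

lemma below_total: "a \<sqsubseteq> b \<or> b \<sqsubseteq> a"
  using total by (simp add: below_def)

lemma below_decompose: "a \<sqsubseteq> b \<Longrightarrow> repr b = a \<boxplus> neg (neg b \<boxplus> a)"
  using join_commute[of a b] by (simp add: below_def plus_commute)

lemma below_plus: "a \<sqsubseteq> a \<boxplus> c"
  unfolding below_def plus_assoc[symmetric] by simp

lemma below_trans: "a \<sqsubseteq> b \<Longrightarrow> b \<sqsubseteq> c \<Longrightarrow> a \<sqsubseteq> c"
  using below_decompose[of b c] by (metis below_def plus_assoc repr_plus_right one_plus)

lemma plus_mono: "a \<sqsubseteq> b \<Longrightarrow> a \<boxplus> c \<sqsubseteq> b \<boxplus> c"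
proof -
  assume "a \<sqsubseteq> b"
  then have "b \<boxplus> c = (a \<boxplus> c) \<boxplus> neg (neg b \<boxplus> a)"
    using below_decompose[of a b] repr_plus_left[of b c] by (simp add: plus_ac)
  then show ?thesis by (simp add: below_plus)
qed

lemma zero_below: "\<zero> \<sqsubseteq> a"
  by (simp add: below_def)

lemma one_below_iff: "\<one> \<sqsubseteq> a \<longleftrightarrow> repr a = \<one>"
  by (simp add: below_def)

lemma plus_eq_one_iff: "a \<boxplus> b = \<one> \<longleftrightarrow> neg a \<sqsubseteq> b"
  by (simp add: below_def)

lemma below_neg_if_plus_ne_one: "a \<boxplus> b \<noteq> \<one> \<Longrightarrow> a \<sqsubseteq> neg b"
  using below_total[of "neg b" a] by (auto simp: plus_eq_one_iff plus_commute[of a])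

lemma neg_below_neg_iff: "neg a \<sqsubseteq> neg b \<longleftrightarrow> b \<sqsubseteq> a"
  by (simp add: below_def plus_commute)

lemma below_neg_swap: "a \<sqsubseteq> neg b \<longleftrightarrow> b \<sqsubseteq> neg a"
  by (simp add: below_def plus_commute)

lemma prod_commute: "a \<boxdot> b = b \<boxdot> a"
  by (simp add: prod_def plus_commute)

lemma neg_prod [simp]: "neg (a \<boxdot> b) = neg a \<boxplus> neg b"
  by (simp add: prod_def)

lemma neg_plus: "neg (a \<boxplus> b) = neg a \<boxdot> neg b"
  by (simp add: prod_def)

lemma repr_prod [simp]: "repr (a \<boxdot> b) = a \<boxdot> b" "repr a \<boxdot> b = a \<boxdot> b" "a \<boxdot> repr b = a \<boxdot> b"
  by (simp_all add: prod_def)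

lemma one_prod [simp]: "\<one> \<boxdot> a = repr a"
  by (simp add: prod_def)

lemma prod_below: "a \<boxdot> b \<sqsubseteq> a"
proof -
  have "neg (neg a \<boxplus> neg b) \<sqsubseteq> neg (neg a)"
    by (simp only: neg_below_neg_iff below_plus)
  then show ?thesis by (simp add: prod_def)
qed

lemma prod_mono: "a \<sqsubseteq> b \<Longrightarrow> a \<boxdot> c \<sqsubseteq> b \<boxdot> c"
  by (simp add: prod_def neg_below_neg_iff plus_mono)

lemma prod_neg_plus: "b \<sqsubseteq> a \<Longrightarrow> (a \<boxdot> neg b) \<boxplus> b = repr a"
  using below_decompose[of b a] by (simp add: prod_def plus_commute)

lemma prod_plus_neg: "a \<boxplus> b = \<one> \<Longrightarrow> (a \<boxdot> b) \<boxplus> neg b = repr a"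
  using prod_neg_plus[of "neg b" a] by (simp add: plus_eq_one_iff plus_commute[of a])

lemma plus_prod_neg:
  assumes "a \<sqsubseteq> neg b"
  shows "(a \<boxplus> b) \<boxdot> neg b = repr a"
proof -
  have "(neg a \<boxdot> neg b) \<boxplus> b = neg a"
    using prod_neg_plus[of b "neg a"] assms by (simp add: below_neg_swap)
  then have "neg ((neg a \<boxdot> neg b) \<boxplus> b) = repr a" by simp
  then show ?thesis by (simp add: neg_plus)
qed

text \<open>Both sides are \<open>a + b + c - 1\<close>.\<close>

lemma plus_prod_exchange:
  assumes "a \<sqsubseteq> neg b" and "a \<sqsubseteq> neg c" and "(a \<boxplus> b) \<boxplus> c = \<one>"
  shows "(a \<boxplus> b) \<boxdot> c = (a \<boxplus> c) \<boxdot> b"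
proof -
  define d where "d = neg (a \<boxplus> b)"
  define s where "s = (a \<boxplus> b) \<boxdot> c"
  have "d \<sqsubseteq> c" using assms(3) by (simp add: d_def below_def)
  then have s_d: "s \<boxplus> d = repr c"
    using prod_neg_plus[of d c] by (simp add: s_def d_def prod_commute)
  have d_a: "d \<boxplus> a = neg b"
    using prod_neg_plus[OF assms(1)] by (simp add: d_def neg_plus prod_commute)
  have d_b: "d \<boxplus> b = neg a"
    using prod_neg_plus[of b "neg a"] assms(1) by (simp add: d_def neg_plus below_neg_swap)
  have "a \<boxplus> c = s \<boxplus> neg b"
    using s_d repr_plus_right[of a c] by (simp add: plus_ac flip: d_a)
  moreover have "s \<sqsubseteq> b"
  proof -
    have "neg s \<boxplus> b = neg c \<boxplus> neg a"
      by (simp add: s_def plus_ac flip: d_b) (simp add: d_def plus_ac)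
    then show ?thesis using assms(2) by (simp add: below_def plus_commute)
  qed
  ultimately show ?thesis
    using plus_prod_neg[of s "neg b"] by (simp add: s_def)
qed

text \<open>
  In Chang's totally ordered group, a pair \<open>(n, a)\<close> with \<open>a \<noteq> \<one>\<close> stands for \<open>n \<cdot> \<one> + a\<close>.
\<close>

definition add_carry :: "'a \<Rightarrow> nat \<times> 'a \<Rightarrow> nat \<times> 'a" where
  "add_carry b = (\<lambda>(n, a). if a \<boxplus> b = \<one> then (Suc n, a \<boxdot> b) else (n, a \<boxplus> b))"

definition normal :: "nat \<times> 'a \<Rightarrow> bool" where
  "normal x \<longleftrightarrow> snd x \<noteq> \<one> \<and> repr (snd x) = snd x"

lemma normal_add_carry: "normal x \<Longrightarrow> normal (add_carry b x)"
  using prod_below[of "snd x" b]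
  by (auto simp: normal_def add_carry_def one_below_iff split: if_splits prod.splits)

lemma add_carry_repr_snd [simp]: "add_carry b (n, repr a) = add_carry b (n, a)"
  by (simp add: add_carry_def)

lemma add_carry_apfst_Suc: "add_carry b (apfst Suc x) = apfst Suc (add_carry b x)"
  by (simp add: add_carry_def split: prod.splits)

lemma add_carry_neg:
  assumes "normal x"
  shows "add_carry (neg b) (add_carry b x) = apfst Suc x"
proof -
  obtain n a where x_eq: "x = (n, a)" by (cases x)
  have digit_a: "a \<noteq> \<one>" "repr a = a" using assms by (simp_all add: x_eq normal_def)
  show ?thesis
  proof (cases "a \<boxplus> b = \<one>")
    case True
    then show ?thesis using digit_a by (simp add: x_eq add_carry_def prod_plus_neg)
  next
    case False
    have "(a \<boxplus> b) \<boxplus> neg b = \<one>" by (simp add: plus_assoc)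
    moreover have "(a \<boxplus> b) \<boxdot> neg b = a"
      using plus_prod_neg[OF below_neg_if_plus_ne_one[OF False]] digit_a by simp
    ultimately show ?thesis using False by (simp add: x_eq add_carry_def)
  qed
qed

lemma add_carry_inject:
  assumes "normal x" and "normal y" and "add_carry b x = add_carry b y"
  shows "x = y"
proof -
  have "apfst Suc x = apfst Suc y"
    using add_carry_neg[OF assms(1)] add_carry_neg[OF assms(2)] assms(3) by metis
  then show ?thesis by (cases x; cases y) simp
qed

lemma add_carry_commute_via_neg:
  assumes "normal x"
    and "add_carry (neg b) (add_carry c (add_carry b x)) =
      add_carry c (add_carry (neg b) (add_carry b x))"
  shows "add_carry b (add_carry c x) = add_carry c (add_carry b x)"
proof (rule add_carry_inject)
  show "add_carry (neg b) (add_carry b (add_carry c x)) =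
      add_carry (neg b) (add_carry c (add_carry b x))"
    using assms by (simp add: add_carry_neg normal_add_carry add_carry_apfst_Suc)
qed (simp_all add: normal_add_carry assms(1))

lemma add_carry_commute_neither_carry:
  assumes "a \<boxplus> b \<noteq> \<one>" and "a \<boxplus> c \<noteq> \<one>"
  shows "add_carry b (add_carry c (n, a)) = add_carry c (add_carry b (n, a))"
proof -
  have "(a \<boxplus> b) \<boxplus> c = (a \<boxplus> c) \<boxplus> b" by (simp add: plus_ac)
  then show ?thesis
    using assms plus_prod_exchange[of a b c] by (auto simp: add_carry_def below_neg_if_plus_ne_one)
qed

text \<open>
  Replacing \<open>b\<close> by \<open>\<not>b\<close> and \<open>(n, a)\<close> by the sum of \<open>(n, a)\<close> and \<open>b\<close> removes a carry.
\<close>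

lemma add_carry_commute_not_both_carry:
  assumes "normal (n, a)" and "a \<boxplus> c \<noteq> \<one>"
  shows "add_carry b (add_carry c (n, a)) = add_carry c (add_carry b (n, a))"
proof (cases "a \<boxplus> b = \<one>")
  case True
  then have "(a \<boxdot> b) \<boxplus> neg b \<noteq> \<one>"
    using assms(1) by (simp add: normal_def prod_plus_neg)
  moreover have "(a \<boxdot> b) \<boxplus> c \<noteq> \<one>"
    using plus_mono[OF prod_below, of a b c] assms(2) by (auto simp: one_below_iff)
  ultimately show ?thesis
    using True by (intro add_carry_commute_via_neg[OF assms(1)])
      (simp add: add_carry_commute_neither_carry add_carry_def[of b])
qed (use assms(2) add_carry_commute_neither_carry in blast)

lemma add_carry_commute: "add_carry b (add_carry c x) = add_carry c (add_carry b x)"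
proof -
  obtain n a where x_eq: "x = (n, a)" by (cases x)
  consider (one) "repr a = \<one>" | (no_carry) "repr a \<noteq> \<one>" "a \<boxplus> c \<noteq> \<one>"
    | (carry) "repr a \<noteq> \<one>" "a \<boxplus> c = \<one>" by blast
  then show ?thesis
  proof cases
    case one
    have "repr a \<boxplus> d = \<one>" "repr a \<boxdot> d = repr d" for d
      unfolding one by simp_all
    then have "add_carry d x = (Suc n, repr d)" for d
      by (simp add: x_eq add_carry_def)
    then show ?thesis by (simp add: add_carry_def plus_commute[of b] prod_commute[of b])
  next
    case no_carry
    then have "add_carry b (add_carry c (n, repr a)) = add_carry c (add_carry b (n, repr a))"
      using add_carry_commute_not_both_carry[of n "repr a" c b] by (simp add: normal_def)
    then show ?thesis by (simp add: x_eq)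
  next
    case carry
    have normal_repr: "normal (n, repr a)" using carry by (simp add: normal_def)
    moreover have "normal (Suc n, a \<boxdot> c)"
      using normal_add_carry[OF normal_repr, of c] carry by (simp add: add_carry_def)
    then have "add_carry (neg c) (add_carry b (add_carry c (n, repr a))) =
        add_carry b (add_carry (neg c) (add_carry c (n, repr a)))"
      using add_carry_commute_not_both_carry[of "Suc n" "a \<boxdot> c" "neg c" b] carry
      by (simp add: add_carry_def[of c] prod_plus_neg)
    ultimately have "add_carry c (add_carry b (n, repr a)) = add_carry b (add_carry c (n, repr a))"
      by (rule add_carry_commute_via_neg)
    then show ?thesis by (simp add: x_eq)
  qed
qed

sublocale add_carry: comp_fun_commute add_carry
  by standard (simp add: fun_eq_iff add_carry_commute)

definition lex_le :: "nat \<times> 'a \<Rightarrow> nat \<times> 'a \<Rightarrow> bool" where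
  "lex_le x y \<longleftrightarrow> fst x < fst y \<or> fst x = fst y \<and> snd x \<sqsubseteq> snd y"

lemma lex_le_refl: "lex_le x x"
  by (simp add: lex_le_def below_refl)

lemma lex_le_trans: "lex_le x y \<Longrightarrow> lex_le y w \<Longrightarrow> lex_le x w"
  by (auto simp: lex_le_def intro: below_trans)

lemma lex_le_total: "lex_le x y \<or> lex_le y x"
  using below_total by (auto simp: lex_le_def)

lemma lex_le_antisym: "normal x \<Longrightarrow> normal y \<Longrightarrow> lex_le x y \<Longrightarrow> lex_le y x \<Longrightarrow> x = y"
  using below_antisym[of "snd x" "snd y"] by (auto simp: lex_le_def normal_def prod_eq_iff)

lemma add_carry_mono:
  assumes "lex_le x y"
  shows "lex_le (add_carry b x) (add_carry b y)"
proof -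
  obtain n a m a' where xy_eq: "x = (n, a)" "y = (m, a')" by (cases x, cases y)
  from assms consider (less) "n < m" | (eq) "n = m" "a \<sqsubseteq> a'" by (auto simp: xy_eq lex_le_def)
  then show ?thesis
  proof cases
    case less
    have "b \<sqsubseteq> a' \<boxplus> b" "a \<boxdot> b \<sqsubseteq> b"
      using below_plus[of b a'] prod_below[of b a] by (simp_all add: plus_commute prod_commute)
    then have "a \<boxdot> b \<sqsubseteq> a' \<boxplus> b" by (blast intro: below_trans)
    with less show ?thesis by (auto simp: xy_eq lex_le_def add_carry_def)
  next
    case eq
    then have "a \<boxplus> b \<sqsubseteq> a' \<boxplus> b" by (intro plus_mono)
    moreover from this have "a \<boxplus> b = \<one> \<Longrightarrow> a' \<boxplus> b = \<one>" by (simp add: one_below_iff)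
    ultimately show ?thesis using eq prod_mono by (auto simp: xy_eq lex_le_def add_carry_def)
  qed
qed

lemma add_carry_le_iff:
  assumes "normal x" and "normal y"
  shows "lex_le (add_carry b x) (add_carry b y) \<longleftrightarrow> lex_le x y"
proof
  assume carry_le: "lex_le (add_carry b x) (add_carry b y)"
  show "lex_le x y"
  proof (rule ccontr)
    assume "\<not> lex_le x y"
    then have "lex_le (add_carry b y) (add_carry b x)"
      using lex_le_total add_carry_mono by blast
    with carry_le assms have "add_carry b x = add_carry b y"
      by (intro lex_le_antisym normal_add_carry)
    then have "x = y" by (rule add_carry_inject[OF assms])
    with \<open>\<not> lex_le x y\<close> show False by (simp add: lex_le_refl)
  qed
qed (rule add_carry_mono)

definition carry_sum :: "'a multiset \<Rightarrow> nat \<times> 'a" where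
  "carry_sum M = fold_mset add_carry (0, \<zero>) M"

lemma carry_sum_empty [simp]: "carry_sum {#} = (0, \<zero>)"
  by (simp add: carry_sum_def)

lemma carry_sum_add [simp]: "carry_sum (add_mset a M) = add_carry a (carry_sum M)"
  by (simp add: carry_sum_def)

lemma normal_carry_sum: "normal (carry_sum M)"
proof (induction M)
  case empty
  show ?case using nontrivial by (simp add: normal_def)
qed (simp add: normal_add_carry)

definition sum_le :: "'a multiset \<Rightarrow> 'a multiset \<Rightarrow> bool" where
  "sum_le M N \<longleftrightarrow> lex_le (carry_sum M) (carry_sum N)"

sublocale sums: multiset_preorder sum_le
proof
  show "sum_le (K + M) (K + N) \<longleftrightarrow> sum_le M N" for K M N
    by (induction K) (simp_all add: sum_le_def add_carry_le_iff normal_carry_sum)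
qed (auto simp: sum_le_def lex_le_total intro: lex_le_trans)

lemma add_carry_zero:
  "add_carry a (n, \<zero>) = (if repr a = \<one> then (Suc n, \<zero>) else (n, repr a))"
  by (simp add: add_carry_def prod_def)

lemma empty_sum_le: "sum_le {#} M"
  by (auto simp: sum_le_def lex_le_def zero_below)

lemma not_one_sum_le_empty: "\<not> sum_le {#\<one>#} {#}"
  by (simp add: sum_le_def lex_le_def add_carry_zero)

lemma sum_le_one: "sum_le {#a#} {#\<one>#}"
  by (simp add: sum_le_def lex_le_def add_carry_zero below_refl)

lemma one_sum_le_iff: "sum_le {#\<one>#} {#a#} \<longleftrightarrow> repr a = \<one>"
  by (simp add: sum_le_def lex_le_def add_carry_zero below_refl)

lemma one_sum_le_pair: "a \<boxplus> b = \<one> \<Longrightarrow> sum_le {#\<one>#} {#a, b#}"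
  by (auto simp: sum_le_def lex_le_def add_carry_zero)
     (auto simp: add_carry_def zero_below plus_commute)

lemma carry_sum_pair:
  assumes "repr c = a \<boxplus> b" and "a \<boxplus> b \<noteq> \<one>"
  shows "carry_sum {#a, b#} = carry_sum {#c#}"
proof -
  have "repr b \<noteq> \<one>" using assms(2) by (metis repr_plus_right plus_one)
  then have "carry_sum {#a, b#} = (0, b \<boxplus> a)"
    using assms(2) by (simp add: add_carry_zero plus_commute) (simp add: add_carry_def plus_commute)
  then show ?thesis using assms by (simp add: add_carry_zero plus_commute)
qed

lemma carry_sum_neg:
  assumes "repr b = neg a"
  shows "carry_sum {#a, b#} = carry_sum {#\<one>#}"
proof (cases "neg a = \<one>")
  case True
  then have "repr a = \<zero>" by (metis neg_neg repr_zero)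
  then show ?thesis using assms True nontrivial by (simp add: add_carry_zero)
next
  case False
  have "carry_sum {#a, b#} = add_carry a (0, neg a)"
    using assms False by (simp add: add_carry_zero)
  then show ?thesis by (simp add: add_carry_zero) (simp add: add_carry_def prod_def)
qed

lemma ex_additive_weight:
  assumes "finite A"
  obtains w :: "'a \<Rightarrow> real"
  where "w \<one> > 0"
    and "\<And>a. a \<in> A \<Longrightarrow> 0 \<le> w a" and "\<And>a. a \<in> A \<Longrightarrow> w a \<le> w \<one>"
    and "\<And>a. a \<in> A \<Longrightarrow> w a = w \<one> \<longleftrightarrow> repr a = \<one>"
    and "\<And>a b. a \<in> A \<Longrightarrow> b \<in> A \<Longrightarrow> repr b = neg a \<Longrightarrow> w a + w b = w \<one>"
    and "\<And>a b. a \<in> A \<Longrightarrow> b \<in> A \<Longrightarrow> a \<boxplus> b = \<one> \<Longrightarrow> w \<one> \<le> w a + w b"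
    and "\<And>a b c. a \<in> A \<Longrightarrow> b \<in> A \<Longrightarrow> c \<in> A \<Longrightarrow> repr c = a \<boxplus> b \<Longrightarrow> a \<boxplus> b \<noteq> \<one> \<Longrightarrow>
      w c = w a + w b"
proof -
  define B where
    "B = insert {#} ((\<lambda>a. {#a#}) ` insert \<one> A \<union> (\<lambda>(a, b). {#a, b#}) ` (A \<times> A))"
  have "finite B" using assms by (simp add: B_def)
  then obtain w :: "'a \<Rightarrow> real" where
    sum_le_iff: "\<And>M N. M \<in> B \<Longrightarrow> N \<in> B \<Longrightarrow> sum_le M N \<longleftrightarrow> (\<Sum>x\<in>#M. w x) \<le> (\<Sum>x\<in>#N. w x)"
    using sums.ex_real_weights by blast
  have w_eq: "(\<Sum>x\<in>#M. w x) = (\<Sum>x\<in>#N. w x)"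
    if "M \<in> B" "N \<in> B" "carry_sum M = carry_sum N" for M N
    using that sum_le_iff[of M N] sum_le_iff[of N M] by (simp add: sum_le_def lex_le_refl)
  have in_B: "{#} \<in> B" "{#\<one>#} \<in> B" "a \<in> A \<Longrightarrow> {#a#} \<in> B" "a \<in> A \<Longrightarrow> b \<in> A \<Longrightarrow> {#a, b#} \<in> B" for a b
    by (auto simp: B_def)
  show thesis
  proof (rule that)
    show "w \<one> > 0" using sum_le_iff[of "{#\<one>#}" "{#}"] not_one_sum_le_empty in_B by simp
    show "0 \<le> w a" if "a \<in> A" for a
      using sum_le_iff[of "{#}" "{#a#}"] empty_sum_le in_B that by simp
    show "w a \<le> w \<one>" if "a \<in> A" for a
      using sum_le_iff[of "{#a#}" "{#\<one>#}"] sum_le_one in_B that by simp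
    then show "w a = w \<one> \<longleftrightarrow> repr a = \<one>" if "a \<in> A" for a
      using sum_le_iff[of "{#\<one>#}" "{#a#}"] one_sum_le_iff[of a] in_B that by force
    show "w a + w b = w \<one>" if "a \<in> A" "b \<in> A" "repr b = neg a" for a b
      using w_eq[OF _ _ carry_sum_neg[OF that(3)]] in_B that by simp
    show "w \<one> \<le> w a + w b" if "a \<in> A" "b \<in> A" "a \<boxplus> b = \<one>" for a b
      using sum_le_iff[of "{#\<one>#}" "{#a, b#}"] one_sum_le_pair in_B that by simp
    show "w c = w a + w b"
      if "a \<in> A" "b \<in> A" "c \<in> A" "repr c = a \<boxplus> b" "a \<boxplus> b \<noteq> \<one>" for a b c
      using w_eq[OF _ _ carry_sum_pair[OF that(4,5)]] in_B that by simp
  qed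
qed

theorem ex_partial_embedding:
  assumes "finite A"
  obtains h :: "'a \<Rightarrow> real"
  where "\<And>a. a \<in> A \<Longrightarrow> h a \<in> {0..1}"
    and "\<And>a. a \<in> A \<Longrightarrow> h a = 1 \<longleftrightarrow> repr a = \<one>"
    and "\<And>a b. a \<in> A \<Longrightarrow> b \<in> A \<Longrightarrow> repr b = neg a \<Longrightarrow> h b = mv_neg (h a)"
    and "\<And>a b c. a \<in> A \<Longrightarrow> b \<in> A \<Longrightarrow> c \<in> A \<Longrightarrow> repr c = a \<boxplus> b \<Longrightarrow> h c = mv_oplus (h a) (h b)"
proof -
  obtain w :: "'a \<Rightarrow> real" where w_one: "w \<one> > 0"
    and w_nonneg: "\<And>a. a \<in> A \<Longrightarrow> 0 \<le> w a" and w_le: "\<And>a. a \<in> A \<Longrightarrow> w a \<le> w \<one>"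
    and w_eq_one: "\<And>a. a \<in> A \<Longrightarrow> w a = w \<one> \<longleftrightarrow> repr a = \<one>"
    and w_neg: "\<And>a b. a \<in> A \<Longrightarrow> b \<in> A \<Longrightarrow> repr b = neg a \<Longrightarrow> w a + w b = w \<one>"
    and w_carry: "\<And>a b. a \<in> A \<Longrightarrow> b \<in> A \<Longrightarrow> a \<boxplus> b = \<one> \<Longrightarrow> w \<one> \<le> w a + w b"
    and w_plus: "\<And>a b c. a \<in> A \<Longrightarrow> b \<in> A \<Longrightarrow> c \<in> A \<Longrightarrow> repr c = a \<boxplus> b \<Longrightarrow> a \<boxplus> b \<noteq> \<one> \<Longrightarrow>
      w c = w a + w b"
    by (rule ex_additive_weight[OF assms]) (rule that)
  show thesis
  proof (rule that)
    show "w a / w \<one> \<in> {0..1}" "w a / w \<one> = 1 \<longleftrightarrow> repr a = \<one>" if "a \<in> A" for a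
      using w_one w_nonneg[OF that] w_le[OF that] w_eq_one[OF that] by auto
    show "w b / w \<one> = mv_neg (w a / w \<one>)" if "a \<in> A" "b \<in> A" "repr b = neg a" for a b
      using w_neg[OF that] w_one by (simp add: mv_neg_def field_simps)
    show "w c / w \<one> = mv_oplus (w a / w \<one>) (w b / w \<one>)"
      if "a \<in> A" "b \<in> A" "c \<in> A" "repr c = a \<boxplus> b" for a b c
    proof (cases "a \<boxplus> b = \<one>")
      case True
      then have "w \<one> \<le> w a + w b" "w c = w \<one>" using w_carry w_eq_one that by simp_all
      then show ?thesis using w_one by (simp add: mv_oplus_def field_simps)
    next
      case False
      then show ?thesis
        using w_plus[OF that] w_one w_le[OF that(3)] by (simp add: mv_oplus_def field_simps)
    qed
  qed
qed

end

section \<open>Valuations approximating a prime theory\<close>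

lemma finite_bounded_size:
  assumes "finite H"
  shows "finite {\<phi> :: 'x luk_form. vars \<phi> \<subseteq> H \<and> size \<phi> \<le> k}"
proof (induction k)
  case 0
  show ?case by (simp add: luk_form.size_neq)
next
  case (Suc k)
  let ?F = "{\<phi> :: 'x luk_form. vars \<phi> \<subseteq> H \<and> size \<phi> \<le> k}"
  let ?G = "Var ` H \<union> Neg ` ?F \<union> (\<lambda>(\<phi>, \<psi>). Imp \<phi> \<psi>) ` (?F \<times> ?F)"
  have "\<phi> \<in> ?G" if "vars \<phi> \<subseteq> H" "size \<phi> \<le> Suc k" for \<phi>
    using that by (cases \<phi>) auto
  then have "{\<phi>. vars \<phi> \<subseteq> H \<and> size \<phi> \<le> Suc k} \<subseteq> ?G" by blast
  moreover have "finite ?G" using assms Suc.IH by blast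
  ultimately show ?case by (rule finite_subset)
qed

lemma luk_eval_cong: "(\<And>x. x \<in> vars \<phi> \<Longrightarrow> v x = v' x) \<Longrightarrow> luk_eval v \<phi> = luk_eval v' \<phi>"
  by (induction \<phi>) auto

context prime_theory
begin

definition rep :: "'a luk_form \<Rightarrow> 'a luk_form" where
  "rep a = (SOME b. a \<doteq> b)"

lemma equivalent_rep: "a \<doteq> rep a"
  unfolding rep_def by (rule someI) (rule equivalent_refl)

lemma rep_eq_iff: "rep a = rep b \<longleftrightarrow> a \<doteq> b"
proof
  assume "rep a = rep b"
  then show "a \<doteq> b" by (metis equivalent_rep equivalent_sym equivalent_trans)
next
  assume "a \<doteq> b"
  then have "a \<doteq> c \<longleftrightarrow> b \<doteq> c" for c by (meson equivalent_sym equivalent_trans)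
  then show "rep a = rep b" by (simp add: rep_def)
qed

lemma Oplus_cong: "a \<doteq> a' \<Longrightarrow> b \<doteq> b' \<Longrightarrow> Oplus a b \<doteq> Oplus a' b'"
  unfolding Oplus_def by (intro Imp_cong Neg_cong)

lemma Oplus_commute: "Oplus a b \<doteq> Oplus b a"
  unfolding Oplus_def
  by (rule equivalent_trans[OF Imp_contrapos Imp_cong[OF equivalent_refl Neg_Neg]])

lemma Oplus_assoc: "Oplus (Oplus a b) c \<doteq> Oplus a (Oplus b c)"
proof -
  have "Oplus (Oplus a b) c \<doteq> Oplus c (Oplus a b)" by (rule Oplus_commute)
  also have "\<dots> \<doteq> Oplus a (Oplus c b)" unfolding Oplus_def by (rule exchange)
  also have "\<dots> \<doteq> Oplus a (Oplus b c)" by (intro Oplus_cong equivalent_refl Oplus_commute)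
  finally show ?thesis .
qed

lemma Oplus_Neg_left: "Oplus (Neg a) b \<doteq> Imp a b"
  unfolding Oplus_def by (intro Imp_cong Neg_Neg equivalent_refl)

lemma Oplus_Bot: "Oplus a Bot \<doteq> a"
  unfolding Oplus_def
  by (rule equivalent_trans[OF equivalent_sym[OF Neg_equivalent_Imp_Bot] Neg_Neg])

lemma Neg_Bot_in: "Neg Bot \<in> T"
  using Neg_Neg[of Top] equivalent_Top_iff by (simp add: Bot_def)

lemma Oplus_Neg_Bot_in: "Oplus a (Neg Bot) \<in> T"
  unfolding Oplus_def by (rule implies_member[OF Neg_Bot_in])

lemma Oplus_join: "Oplus (Neg (Oplus (Neg a) b)) b \<doteq> Join a b"
  by (rule equivalent_trans[OF Oplus_Neg_left Imp_cong[OF Oplus_Neg_left equivalent_refl]])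

lemma Oplus_join_commute:
  "Oplus (Neg (Oplus (Neg a) b)) b \<doteq> Oplus (Neg (Oplus (Neg b) a)) a"
  by (rule equivalent_trans[OF Oplus_join
        equivalent_trans[OF Join_commute equivalent_sym[OF Oplus_join]]])

lemma Bot_notin: "Bot \<notin> T"
  using proper Bot_implies mp by blast

lemma rep_simps:
  "rep (rep a) = rep a" "rep (Neg (rep a)) = rep (Neg a)"
  "rep (Oplus (rep a) b) = rep (Oplus a b)" "rep (Oplus a (rep b)) = rep (Oplus a b)"
  by (simp_all add: rep_eq_iff Neg_cong Oplus_cong equivalent_rep equivalent_refl equivalent_sym)

lemma rep_eq_rep_Neg_Bot_iff: "rep a = rep (Neg Bot) \<longleftrightarrow> a \<in> T"
  by (metis Neg_Bot_in equivalent_Top_iff equivalent_sym equivalent_trans rep_eq_iff)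

sublocale lindenbaum: mv_chain rep "\<lambda>a. rep (Neg a)" "\<lambda>a b. rep (Oplus a b)" "rep Bot"
proof
  show "rep (Oplus (rep (Oplus a b)) c) = rep (Oplus a (rep (Oplus b c)))" for a b c
    by (simp add: rep_simps) (simp add: rep_eq_iff Oplus_assoc)
  show "rep (Oplus (rep (Neg (rep (Oplus (rep (Neg a)) b)))) b) =
      rep (Oplus (rep (Neg (rep (Oplus (rep (Neg b)) a)))) a)" for a b
    by (simp add: rep_simps) (simp add: rep_eq_iff Oplus_join_commute)
  show "rep (Oplus (rep (Neg a)) b) = rep (Neg (rep Bot)) \<or>
      rep (Oplus (rep (Neg b)) a) = rep (Neg (rep Bot))" for a b
    using linear[of a b] equivalent_member_iff[OF Oplus_Neg_left]
    by (simp add: rep_simps rep_eq_rep_Neg_Bot_iff)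
  show "rep (Neg (rep Bot)) \<noteq> rep Bot"
    using Bot_notin rep_eq_rep_Neg_Bot_iff[of Bot] by (auto simp: rep_simps)
qed (simp_all add: rep_simps, simp_all add: rep_eq_iff Oplus_commute Oplus_Bot Neg_Neg,
  simp add: rep_eq_rep_Neg_Bot_iff Oplus_Neg_Bot_in flip: rep_eq_iff)

lemma ex_truth_assignment:
  assumes "finite F"
  obtains h :: "'a luk_form \<Rightarrow> real"
  where "\<And>\<phi>. \<phi> \<in> F \<Longrightarrow> h \<phi> \<in> {0..1}"
    and "\<And>\<phi>. \<phi> \<in> F \<Longrightarrow> h \<phi> = 1 \<longleftrightarrow> \<phi> \<in> T"
    and "\<And>\<phi>. \<phi> \<in> F \<Longrightarrow> h (Neg \<phi>) = mv_neg (h \<phi>)"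
    and "\<And>\<phi> \<psi>. \<phi> \<in> F \<Longrightarrow> \<psi> \<in> F \<Longrightarrow> Imp \<phi> \<psi> \<in> F \<Longrightarrow> h (Imp \<phi> \<psi>) = mv_oplus (mv_neg (h \<phi>)) (h \<psi>)"
proof -
  have rep_Imp: "rep (Imp \<phi> \<psi>) = rep (Oplus (Neg \<phi>) \<psi>)" for \<phi> \<psi>
    by (simp add: rep_eq_iff equivalent_sym Oplus_Neg_left)
  have "finite (F \<union> Neg ` F)" using assms by simp
  then show thesis
  proof (rule lindenbaum.ex_partial_embedding)
    fix h :: "'a luk_form \<Rightarrow> real"
    let ?A = "F \<union> Neg ` F"
    assume "\<And>a. a \<in> ?A \<Longrightarrow> h a \<in> {0..1}"
      and "\<And>a. a \<in> ?A \<Longrightarrow> h a = 1 \<longleftrightarrow> rep a = rep (Neg (rep Bot))"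
      and neg: "\<And>a b. a \<in> ?A \<Longrightarrow> b \<in> ?A \<Longrightarrow> rep b = rep (Neg a) \<Longrightarrow> h b = mv_neg (h a)"
      and plus: "\<And>a b c. a \<in> ?A \<Longrightarrow> b \<in> ?A \<Longrightarrow> c \<in> ?A \<Longrightarrow> rep c = rep (Oplus a b) \<Longrightarrow>
        h c = mv_oplus (h a) (h b)"
    moreover have "h (Neg \<phi>) = mv_neg (h \<phi>)" if "\<phi> \<in> F" for \<phi>
      using that neg[of \<phi> "Neg \<phi>"] by simp
    moreover from this have "h (Imp \<phi> \<psi>) = mv_oplus (mv_neg (h \<phi>)) (h \<psi>)"
      if "\<phi> \<in> F" "\<psi> \<in> F" "Imp \<phi> \<psi> \<in> F" for \<phi> \<psi>
      using that plus[of "Neg \<phi>" \<psi> "Imp \<phi> \<psi>"] by (simp add: rep_Imp)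
    ultimately show thesis
      by (intro that[of h]) (simp_all add: rep_simps rep_eq_rep_Neg_Bot_iff)
  qed
qed

lemma ex_valuation:
  assumes "finite H"
  obtains v where "v \<in> cube H"
    and "\<And>\<phi>. vars \<phi> \<subseteq> H \<Longrightarrow> size \<phi> \<le> k \<Longrightarrow> luk_eval v \<phi> = 1 \<longleftrightarrow> \<phi> \<in> T"
proof -
  define F where "F = {\<phi> :: 'a luk_form. vars \<phi> \<subseteq> H \<and> size \<phi> \<le> Suc k}"
  have "finite F" using finite_bounded_size[OF assms] by (simp add: F_def)
  then obtain h where h_range: "\<And>\<phi>. \<phi> \<in> F \<Longrightarrow> h \<phi> \<in> {0..1}"
    and h_one: "\<And>\<phi>. \<phi> \<in> F \<Longrightarrow> h \<phi> = 1 \<longleftrightarrow> \<phi> \<in> T"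
    and h_Neg: "\<And>\<phi>. \<phi> \<in> F \<Longrightarrow> h (Neg \<phi>) = mv_neg (h \<phi>)"
    and h_Imp: "\<And>\<phi> \<psi>. \<phi> \<in> F \<Longrightarrow> \<psi> \<in> F \<Longrightarrow> Imp \<phi> \<psi> \<in> F \<Longrightarrow>
      h (Imp \<phi> \<psi>) = mv_oplus (mv_neg (h \<phi>)) (h \<psi>)"
    by (rule ex_truth_assignment) (rule that)
  define v where "v = (\<lambda>x\<in>H. h (Var x))"
  have luk_eval_v: "luk_eval v \<phi> = h \<phi>" if "\<phi> \<in> F" for \<phi>
    using that
  proof (induction \<phi>)
    case (Var x)
    then show ?case by (simp add: F_def v_def)
  next
    case (Neg \<phi>)
    then show ?case using h_Neg[of \<phi>] by (simp add: F_def)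
  next
    case (Imp \<phi> \<psi>)
    then show ?case using h_Imp[of \<phi> \<psi>] by (simp add: F_def)
  qed
  show thesis
  proof (rule that)
    show "v \<in> cube H" using h_range[of "Var _"] by (auto simp: v_def cube_def F_def)
    show "luk_eval v \<phi> = 1 \<longleftrightarrow> \<phi> \<in> T" if "vars \<phi> \<subseteq> H" "size \<phi> \<le> k" for \<phi>
      using luk_eval_v h_one that by (simp add: F_def)
  qed
qed

end

section \<open>Tangent directions of a sequence\<close>

definition dot :: "'x set \<Rightarrow> ('x \<Rightarrow> real) \<Rightarrow> ('x \<Rightarrow> real) \<Rightarrow> real" where
  "dot H u v = (\<Sum>x\<in>H. u x * v x)"

definition orthonormal :: "'x set \<Rightarrow> ('i \<Rightarrow> 'x \<Rightarrow> real) \<Rightarrow> 'i set \<Rightarrow> bool" where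
  "orthonormal H u J \<longleftrightarrow> (\<forall>i\<in>J. \<forall>j\<in>J. dot H (u i) (u j) = (if i = j then 1 else 0))"

lemma dot_self: "dot H u u = (L2_set u H)\<^sup>2"
  by (simp add: dot_def L2_set_def sum_nonneg power2_eq_square)

lemma dot_commute: "dot H u v = dot H v u"
  by (simp add: dot_def mult.commute)

lemma dot_diff_left: "dot H (\<lambda>x. u x - v x) w = dot H u w - dot H v w"
  by (simp add: dot_def left_diff_distrib sum_subtractf)

lemma dot_scale_left: "dot H (\<lambda>x. c * u x) v = c * dot H u v"
  by (simp add: dot_def sum_distrib_left mult.assoc)

lemma dot_divide_left: "dot H (\<lambda>x. u x / c) v = dot H u v / c"
  by (simp add: dot_def sum_divide_distrib)

lemma dot_sum_left: "dot H (\<lambda>x. \<Sum>i\<in>J. u i x) v = (\<Sum>i\<in>J. dot H (u i) v)"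
  unfolding dot_def sum_distrib_right by (rule sum.swap)

lemma tendsto_dot:
  assumes "\<And>x. x \<in> H \<Longrightarrow> ((\<lambda>k. f k x) \<longlongrightarrow> l x) F" and "\<And>x. x \<in> H \<Longrightarrow> ((\<lambda>k. g k x) \<longlongrightarrow> m x) F"
  shows "((\<lambda>k. dot H (f k) (g k)) \<longlongrightarrow> dot H l m) F"
  unfolding dot_def using assms by (intro tendsto_sum tendsto_mult)

lemma tendsto_L2_set:
  assumes "\<And>x. x \<in> H \<Longrightarrow> ((\<lambda>k. f k x) \<longlongrightarrow> l x) F"
  shows "((\<lambda>k. L2_set (f k) H) \<longlongrightarrow> L2_set l H) F"
  unfolding L2_set_def using assms by (intro tendsto_intros)

lemma bessel_inequality:
  assumes "finite J" and "orthonormal H u J"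
  shows "(\<Sum>i\<in>J. (dot H v (u i))\<^sup>2) \<le> dot H v v"
proof -
  define s where "s x = (\<Sum>i\<in>J. dot H v (u i) * u i x)" for x
  have dot_s: "dot H s w = (\<Sum>i\<in>J. dot H v (u i) * dot H (u i) w)" for w
    unfolding s_def dot_sum_left by (simp add: dot_scale_left)
  have "dot H s (u j) = dot H v (u j)" if "j \<in> J" for j
  proof -
    have "dot H s (u j) = (\<Sum>i\<in>J. if i = j then dot H v (u j) else 0)"
      unfolding dot_s using assms(2) that by (intro sum.cong) (auto simp: orthonormal_def)
    then show ?thesis using assms(1) that by simp
  qed
  then have dot_s_s: "dot H s s = (\<Sum>i\<in>J. (dot H v (u i))\<^sup>2)"
    unfolding dot_s[of s] by (simp add: dot_commute[of H _ s] power2_eq_square)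
  have dot_s_v: "dot H s v = (\<Sum>i\<in>J. (dot H v (u i))\<^sup>2)"
    unfolding dot_s by (simp add: dot_commute[of H _ v] power2_eq_square)
  have "0 \<le> dot H (\<lambda>x. v x - s x) (\<lambda>x. v x - s x)"
    by (simp add: dot_self)
  also have "\<dots> = dot H v v - dot H s v - (dot H s v - dot H s s)"
    by (simp only: dot_diff_left dot_commute[of H _ "\<lambda>x. v x - s x"] dot_commute[of H v s])
  finally show ?thesis by (simp add: dot_s_s dot_s_v)
qed

lemma orthonormal_card_le:
  assumes "finite H" and "finite J" and "orthonormal H u J"
  shows "card J \<le> card H"
proof -
  define e :: "'a \<Rightarrow> 'a \<Rightarrow> real" where "e x = (\<lambda>y. if y = x then 1 else 0)" for x
  have dot_e: "dot H (e x) v = v x" if "x \<in> H" for x v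
    using assms(1) that by (simp add: dot_def e_def if_distrib[of "\<lambda>t. t * _"] cong: if_cong)
  have "real (card J) = (\<Sum>i\<in>J. dot H (u i) (u i))"
    using assms(3) by (simp add: orthonormal_def)
  also have "\<dots> = (\<Sum>x\<in>H. \<Sum>i\<in>J. (u i x)\<^sup>2)"
    unfolding dot_def power2_eq_square by (rule sum.swap)
  also have "\<dots> \<le> (\<Sum>x\<in>H. 1)"
  proof (rule sum_mono)
    fix x assume "x \<in> H"
    then show "(\<Sum>i\<in>J. (u i x)\<^sup>2) \<le> 1"
      using bessel_inequality[OF assms(2,3), of "e x"] by (simp add: dot_e) (simp add: e_def)
  qed
  finally show ?thesis by simp
qed

lemma pointwise_convergent_subsequence:
  fixes f :: "nat \<Rightarrow> 'x \<Rightarrow> real"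
  assumes "finite H" and "\<And>k x. x \<in> H \<Longrightarrow> \<bar>f k x\<bar> \<le> B"
  obtains l s where "strict_mono s" and "\<And>x. x \<in> H \<Longrightarrow> (\<lambda>k. f (s k) x) \<longlonglongrightarrow> l x"
proof -
  have "\<forall>d\<subseteq>H. \<exists>l s. strict_mono s \<and>
      (\<forall>e>0. \<forall>\<^sub>F k in sequentially. \<forall>x\<in>d. dist (f (s k) x) (l x) < e)"
    using assms by (intro compact_lemma_general[where unproj = "\<lambda>g. g"])
      (auto intro!: boundedI[of _ B])
  then obtain l s where "strict_mono s"
    and close: "\<And>e. e > 0 \<Longrightarrow> \<forall>\<^sub>F k in sequentially. \<forall>x\<in>H. dist (f (s k) x) (l x) < e"
    by blast
  show thesis
  proof (rule that)
    show "strict_mono s" by fact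
    show "(\<lambda>k. f (s k) x) \<longlonglongrightarrow> l x" if "x \<in> H" for x
      by (rule tendstoI, rule eventually_mono[OF close]) (use that in auto)
  qed
qed

lemma dot_normalized_tendsto:
  assumes "\<And>x. x \<in> H \<Longrightarrow> (\<lambda>k. q k x / L2_set (q k) H) \<longlonglongrightarrow> l x"
  shows "(\<lambda>k. dot H (q k) v / L2_set (q k) H) \<longlonglongrightarrow> dot H l v"
proof -
  have "(\<lambda>k. dot H (\<lambda>x. q k x / L2_set (q k) H) v) \<longlonglongrightarrow> dot H l v"
    by (intro tendsto_dot assms tendsto_const)
  then show ?thesis by (simp add: dot_divide_left)
qed

lemma ex_limit_direction:
  fixes q :: "nat \<Rightarrow> 'x \<Rightarrow> real"
  assumes "finite H" and nonzero: "\<And>k. L2_set (q k) H > 0"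
  obtains l s where "strict_mono s" and "dot H l l = 1" and "\<And>k. dot H (q (s k)) l > 0"
    and "\<And>x. x \<in> H \<Longrightarrow> (\<lambda>k. q (s k) x / L2_set (q (s k)) H) \<longlonglongrightarrow> l x"
proof -
  define e where "e k x = q k x / L2_set (q k) H" for k x
  have "\<bar>e k x\<bar> \<le> 1" if "x \<in> H" for k x
    using member_le_L2_set[OF assms(1) that, of "\<lambda>x. \<bar>q k x\<bar>"] nonzero[of k]
    by (simp add: e_def L2_set_def)
  then obtain l s where "strict_mono s" and lim: "\<And>x. x \<in> H \<Longrightarrow> (\<lambda>k. e (s k) x) \<longlonglongrightarrow> l x"
    using pointwise_convergent_subsequence[OF assms(1), of e 1] by metis
  have "dot H (e k) (e k) = dot H (q k) (q k) / (L2_set (q k) H)\<^sup>2" for k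
    by (simp add: dot_def e_def power2_eq_square sum_divide_distrib)
  then have "dot H (e k) (e k) = 1" for k
    using nonzero[of k] by (simp add: dot_self)
  moreover have "(\<lambda>k. dot H (e (s k)) (e (s k))) \<longlonglongrightarrow> dot H l l"
    by (intro tendsto_dot lim)
  ultimately have dot_l_l: "dot H l l = 1" by (simp add: LIMSEQ_const_iff)
  have "(\<lambda>k. dot H (q (s k)) l / L2_set (q (s k)) H) \<longlonglongrightarrow> 1"
    using dot_normalized_tendsto[of H "\<lambda>k. q (s k)" l l] lim by (simp add: e_def dot_l_l)
  then have "\<forall>\<^sub>F k in sequentially. 0 < dot H (q (s k)) l / L2_set (q (s k)) H"
    by (rule order_tendstoD) simp
  then obtain N where pos_from_N: "\<And>k. k \<ge> N \<Longrightarrow> 0 < dot H (q (s k)) l / L2_set (q (s k)) H"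
    by (auto simp: eventually_sequentially)
  show thesis
  proof (rule that)
    show "strict_mono (\<lambda>k. s (k + N))" using \<open>strict_mono s\<close> by (simp add: strict_mono_def)
    show "dot H (q (s (k + N))) l > 0" for k
      using pos_from_N[of "k + N"] nonzero[of "s (k + N)"] by (simp add: zero_less_divide_iff)
    show "(\<lambda>k. q (s (k + N)) x / L2_set (q (s (k + N))) H) \<longlonglongrightarrow> l x" if "x \<in> H" for x
      using lim[OF that] unfolding e_def by (rule LIMSEQ_ignore_initial_segment)
  qed (rule dot_l_l)
qed

lemma dot_limit_direction_asymp:
  assumes "\<And>x. x \<in> H \<Longrightarrow> (\<lambda>k. q k x / L2_set (q k) H) \<longlonglongrightarrow> l x" and "dot H l l = 1"
  shows "(\<lambda>k. dot H (q k) l) \<sim>[sequentially] (\<lambda>k. L2_set (q k) H)"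
proof (rule asymp_equivI')
  have "(\<lambda>k. dot H (q k) l / L2_set (q k) H) \<longlonglongrightarrow> dot H l l"
    by (intro dot_normalized_tendsto assms(1))
  then show "(\<lambda>k. dot H (q k) l / L2_set (q k) H) \<longlonglongrightarrow> 1" by (simp add: assms(2))
qed

lemma limit_direction_remainder:
  assumes "\<And>k. L2_set (q k) H > 0" and "dot H l l = 1"
    and lim: "\<And>x. x \<in> H \<Longrightarrow> (\<lambda>k. q k x / L2_set (q k) H) \<longlonglongrightarrow> l x"
  shows "(\<lambda>k. L2_set (\<lambda>x. q k x - dot H (q k) l * l x) H) \<in> o(\<lambda>k. dot H (q k) l)"
proof -
  have "(\<lambda>k. L2_set (\<lambda>x. q k x / L2_set (q k) H - dot H (q k) l / L2_set (q k) H * l x) H) \<longlonglongrightarrow>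
      L2_set (\<lambda>x. l x - dot H l l * l x) H"
    by (intro tendsto_L2_set tendsto_intros lim dot_normalized_tendsto)
  moreover have "L2_set (\<lambda>x. q k x / L2_set (q k) H - dot H (q k) l / L2_set (q k) H * l x) H =
      L2_set (\<lambda>x. q k x - dot H (q k) l * l x) H / L2_set (q k) H" for k
    using L2_set_left_distrib[of "1 / L2_set (q k) H" "\<lambda>x. q k x - dot H (q k) l * l x" H]
    by (simp add: diff_divide_distrib)
  moreover have "L2_set (\<lambda>x. l x - dot H l l * l x) H = 0"
    by (simp add: assms(2) L2_set_def)
  ultimately have "(\<lambda>k. L2_set (\<lambda>x. q k x - dot H (q k) l * l x) H) \<in> o(\<lambda>k. L2_set (q k) H)"
    using assms(1) by (intro smalloI_tendsto) (simp_all add: less_imp_neq[THEN not_sym])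
  also have "(\<lambda>k. L2_set (q k) H) \<in> O(\<lambda>k. dot H (q k) l)"
    by (rule asymp_equiv_imp_bigo[OF
          asymp_equiv_symI[OF dot_limit_direction_asymp[OF lim assms(2)]]])
  finally show ?thesis .
qed

text \<open>
  The first \<open>n\<close> Bouligand--Severi tangent directions \<open>u\<^sub>1, \<dots>, u\<^sub>n\<close> of the sequence \<open>p\<close> at \<open>u\<^sub>0\<close>,
  along the subsequence \<open>r\<close>, with remainder \<open>q\<close>.
\<close>

locale tangent_flag =
  fixes H :: "'x set" and p :: "nat \<Rightarrow> 'x \<Rightarrow> real" and n :: nat and u :: "nat \<Rightarrow> 'x \<Rightarrow> real"
    and a :: "nat \<Rightarrow> nat \<Rightarrow> real" and r :: "nat \<Rightarrow> nat" and q :: "nat \<Rightarrow> 'x \<Rightarrow> real"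
  assumes strict_mono_r: "strict_mono r"
    and orthonormal_u: "orthonormal H u {1..n}"
    and a_0: "a 0 k = 1"
    and a_pos: "j \<le> n \<Longrightarrow> a j k > 0"
    and a_Suc_smallo: "j < n \<Longrightarrow> a (Suc j) \<in> o(a j)"
    and q_orthogonal: "i \<in> {1..n} \<Longrightarrow> dot H (q k) (u i) = 0"
    and q_smallo: "(\<lambda>k. L2_set (q k) H) \<in> o(a n)"
    and expansion: "x \<in> H \<Longrightarrow> p (r k) x = (\<Sum>j\<le>n. a j k * u j x) + q k x"
begin

lemma subsequence:
  assumes "strict_mono s"
  shows "tangent_flag H p n u (\<lambda>j k. a j (s k)) (\<lambda>k. r (s k)) (\<lambda>k. q (s k))"
proof
  show "strict_mono (\<lambda>k. r (s k))"
    using strict_mono_r assms by (simp add: strict_mono_def)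
  have compose: "(\<lambda>k. f (s k)) \<in> o(\<lambda>k. g (s k))" if "f \<in> o(g)" for f g :: "nat \<Rightarrow> real"
    using that filterlim_subseq[OF assms] by (rule landau_o.small.compose)
  show "(\<lambda>k. a (Suc j) (s k)) \<in> o(\<lambda>k. a j (s k))" if "j < n" for j
    using a_Suc_smallo[OF that] by (rule compose)
  show "(\<lambda>k. L2_set (q (s k)) H) \<in> o(\<lambda>k. a n (s k))"
    using q_smallo by (rule compose)
  show "orthonormal H u {1..n}" by (rule orthonormal_u)
qed (simp_all add: a_0 a_pos q_orthogonal expansion)

lemma orthonormal_extend:
  assumes "dot H l l = 1" and "\<And>i. i \<in> {1..n} \<Longrightarrow> dot H l (u i) = 0"
  shows "orthonormal H (u(Suc n := l)) {1..Suc n}"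
proof -
  have "dot H (u i) l = 0" if "i \<in> {1..n}" for i
    using assms(2)[OF that] by (simp add: dot_commute)
  moreover have "{1..Suc n} = insert (Suc n) {1..n}" by auto
  ultimately show ?thesis using assms orthonormal_u by (simp add: orthonormal_def)
qed

lemma extend_along:
  assumes "\<And>k. L2_set (q k) H > 0" and unit_l: "dot H l l = 1" and pos: "\<And>k. dot H (q k) l > 0"
    and lim: "\<And>x. x \<in> H \<Longrightarrow> (\<lambda>k. q k x / L2_set (q k) H) \<longlonglongrightarrow> l x"
  defines "a' \<equiv> a(Suc n := (\<lambda>k. dot H (q k) l))"
  shows "tangent_flag H p (Suc n) (u(Suc n := l)) a' r (\<lambda>k x. q k x - dot H (q k) l * l x)"
proof
  have dot_l_u: "dot H l (u i) = 0" if "i \<in> {1..n}" for i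
  proof -
    have "(\<lambda>k. dot H (q k) (u i) / L2_set (q k) H) \<longlonglongrightarrow> dot H l (u i)"
      by (intro dot_normalized_tendsto lim)
    then show ?thesis using q_orthogonal[OF that] by (simp add: LIMSEQ_const_iff)
  qed
  with unit_l show "orthonormal H (u(Suc n := l)) {1..Suc n}" by (rule orthonormal_extend)
  show "dot H (\<lambda>x. q k x - dot H (q k) l * l x) ((u(Suc n := l)) i) = 0" if "i \<in> {1..Suc n}" for i k
    using that q_orthogonal[of i k] dot_l_u[of i] unit_l
    by (auto simp: dot_diff_left dot_scale_left le_Suc_eq)
  show "a' (Suc j) \<in> o(a' j)" if "j < Suc n" for j
  proof (cases "j = n")
    case True
    have "(\<lambda>k. dot H (q k) l) \<in> O(\<lambda>k. L2_set (q k) H)"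
      using lim unit_l by (intro asymp_equiv_imp_bigo dot_limit_direction_asymp)
    also note q_smallo
    finally show ?thesis by (simp add: True a'_def)
  next
    case False
    then show ?thesis using a_Suc_smallo that by (simp add: a'_def)
  qed
  show "(\<lambda>k. L2_set (\<lambda>x. q k x - dot H (q k) l * l x) H) \<in> o(a' (Suc n))"
    using limit_direction_remainder[OF assms(1) unit_l lim] by (simp add: a'_def)
  show "a' j k > 0" if "j \<le> Suc n" for j k
    using that pos a_pos by (simp add: a'_def)
  show "p (r k) x = (\<Sum>j\<le>Suc n. a' j k * (u(Suc n := l)) j x) + (q k x - dot H (q k) l * l x)"
    if "x \<in> H" for k x
    using expansion[OF that] by (simp add: a'_def)
qed (simp_all add: strict_mono_r a'_def a_0)

lemma extend:
  assumes "finite H" and "\<And>k. L2_set (q k) H > 0"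
  shows "\<exists>u' a' r' q'. tangent_flag H p (Suc n) u' a' r' q'"
proof -
  obtain l s where mono_s: "strict_mono s" and unit_l: "dot H l l = 1"
    and pos: "\<And>k. dot H (q (s k)) l > 0"
    and lim: "\<And>x. x \<in> H \<Longrightarrow> (\<lambda>k. q (s k) x / L2_set (q (s k)) H) \<longlonglongrightarrow> l x"
    by (rule ex_limit_direction[of H q, OF assms]) (rule that)
  from tangent_flag.extend_along[OF subsequence[OF mono_s] assms(2) unit_l pos lim]
  show ?thesis by blast
qed

lemma exact_or_extend:
  assumes "finite H"
  shows "(\<exists>a' r'. tangent_flag H p n u a' r' (\<lambda>_ _. 0)) \<or>
    (\<exists>u' a' r' q'. tangent_flag H p (Suc n) u' a' r' q')"
proof (cases "finite {k. L2_set (q k) H = 0}")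
  case True
  then obtain N where "{k. L2_set (q k) H = 0} \<subseteq> {..<N}"
    using finite_nat_iff_bounded by blast
  then have "L2_set (q (k + N)) H > 0" for k
    using L2_set_nonneg[of "q (k + N)" H] by (fastforce simp: less_le)
  moreover have "strict_mono (\<lambda>k. k + N)" by (simp add: strict_mono_def)
  ultimately show ?thesis using tangent_flag.extend[OF subsequence assms] by blast
next
  case False
  then obtain s :: "nat \<Rightarrow> nat" where zero_subsequence: "strict_mono s" "\<And>k. L2_set (q (s k)) H = 0"
    using infinite_enumerate by blast
  interpret sub: tangent_flag H p n u "\<lambda>j k. a j (s k)" "\<lambda>k. r (s k)" "\<lambda>k. q (s k)"
    by (rule subsequence[OF zero_subsequence(1)])
  have "q (s k) x = 0" if "x \<in> H" for k x
    using zero_subsequence(2) that assms by (simp add: L2_set_eq_0_iff)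
  then have "tangent_flag H p n u (\<lambda>j k. a j (s k)) (\<lambda>k. r (s k)) (\<lambda>_ _. 0)"
    using sub.strict_mono_r sub.orthonormal_u sub.a_0 sub.a_pos sub.a_Suc_smallo sub.expansion
    by unfold_locales (simp_all add: dot_def L2_set_def)
  then show ?thesis by blast
qed

end

lemma tangent_flag_0:
  assumes "strict_mono r" and "\<And>x. x \<in> H \<Longrightarrow> (\<lambda>k. p (r k) x) \<longlonglongrightarrow> l x"
  shows "tangent_flag H p 0 (\<lambda>_. l) (\<lambda>_ _. 1) r (\<lambda>k x. p (r k) x - l x)"
proof
  have "(\<lambda>k. L2_set (\<lambda>x. p (r k) x - l x) H) \<longlonglongrightarrow> L2_set (\<lambda>x. l x - l x) H"
    by (intro tendsto_L2_set tendsto_intros assms(2))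
  then show "(\<lambda>k. L2_set (\<lambda>x. p (r k) x - l x) H) \<in> o(\<lambda>_. 1)"
    by (intro smalloI_tendsto) (simp_all add: L2_set_def)
qed (simp_all add: assms(1) orthonormal_def)

theorem ex_exact_tangent_flag:
  assumes "finite H" and "\<And>k x. x \<in> H \<Longrightarrow> \<bar>p k x\<bar> \<le> B"
  shows "\<exists>n u a r. tangent_flag H p n u a r (\<lambda>_ _. 0)"
proof (rule ccontr)
  assume not_exact: "\<not> ?thesis"
  have "\<exists>u a r q. tangent_flag H p n u a r q" for n
  proof (induction n)
    case 0
    obtain l r where "strict_mono r" "\<And>x. x \<in> H \<Longrightarrow> (\<lambda>k. p (r k) x) \<longlonglongrightarrow> l x"
      using pointwise_convergent_subsequence[of H p B] assms by metis
    then show ?case by (blast intro: tangent_flag_0)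
  next
    case (Suc n)
    then show ?case using tangent_flag.exact_or_extend assms(1) not_exact by blast
  qed
  then obtain u a r q where "tangent_flag H p (Suc (card H)) u a r q" by blast
  then have "card {1..Suc (card H)} \<le> card H"
    by (intro orthonormal_card_le[OF assms(1) _ tangent_flag.orthonormal_u]) auto
  then show False by simp
qed

section \<open>Germs of functions along a differential valuation\<close>

lemma abel_summation:
  fixes b h :: "nat \<Rightarrow> 'a::comm_ring"
  shows "(\<Sum>i<N. (b i - b (Suc i)) * (\<Sum>j\<le>i. h j)) = (\<Sum>j<N. b j * h j) - b N * (\<Sum>j<N. h j)"
  by (induction N) (simp_all add: algebra_simps flip: lessThan_Suc_atMost)

text \<open>The tail sums \<open>b j = c j + c (j + 1) + \<dots>\<close> of barycentric coordinates \<open>c\<close>.\<close>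

definition tail_weights :: "nat \<Rightarrow> (nat \<Rightarrow> real) \<Rightarrow> bool" where
  "tail_weights N b \<longleftrightarrow> b 0 = 1 \<and> b N = 0 \<and> (\<forall>j<N. b (Suc j) \<le> b j)"

lemma sum_dv_vertex:
  assumes "x \<in> H" and "b (length U) = 0" and "\<And>i. i < length U \<Longrightarrow> c i = b i - b (Suc i)"
  shows "(\<Sum>i<length U. c i * dv_vertex H U m i x) = (\<Sum>j<length U. b j * ((U ! j) x / real m ^ j))"
  using assms abel_summation[of b "\<lambda>j. (U ! j) x / real m ^ j" "length U"]
  by (simp add: dv_vertex_def)

lemma mem_dv_simplex_iff:
  "v \<in> dv_simplex H U m \<longleftrightarrow>
    (\<exists>b. tail_weights (length U) b \<and> v = (\<lambda>x\<in>H. \<Sum>j<length U. b j * ((U ! j) x / real m ^ j)))"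
proof
  assume "v \<in> dv_simplex H U m"
  then obtain c :: "nat \<Rightarrow> real" where c_weights: "\<forall>i<length U. c i \<ge> 0" "(\<Sum>i<length U. c i) = 1"
    and v_eq: "v = (\<lambda>x\<in>H. \<Sum>i<length U. c i * dv_vertex H U m i x)"
    by (auto simp: dv_simplex_def)
  define b where "b j = (\<Sum>i\<in>{j..<length U}. c i)" for j
  have c_eq: "c i = b i - b (Suc i)" if "i < length U" for i
    using that by (simp add: b_def sum.atLeast_Suc_lessThan)
  have "b 0 = 1" "b (length U) = 0" using c_weights(2) by (simp_all add: b_def atLeast0LessThan)
  moreover have "b (Suc j) \<le> b j" if "j < length U" for j
    using c_weights(1) c_eq[OF that] that by fastforce
  ultimately have "tail_weights (length U) b" by (simp add: tail_weights_def)
  moreover have "v = (\<lambda>x\<in>H. \<Sum>j<length U. b j * ((U ! j) x / real m ^ j))"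
    unfolding v_eq using \<open>b (length U) = 0\<close> c_eq by (intro restrict_ext sum_dv_vertex)
  ultimately show "\<exists>b. tail_weights (length U) b \<and>
      v = (\<lambda>x\<in>H. \<Sum>j<length U. b j * ((U ! j) x / real m ^ j))" by blast
next
  assume "\<exists>b. tail_weights (length U) b \<and> v = (\<lambda>x\<in>H. \<Sum>j<length U. b j * ((U ! j) x / real m ^ j))"
  then obtain b where b_weights: "tail_weights (length U) b"
    and v_eq: "v = (\<lambda>x\<in>H. \<Sum>j<length U. b j * ((U ! j) x / real m ^ j))" by blast
  define c where "c i = b i - b (Suc i)" for i
  have "v = (\<lambda>x\<in>H. \<Sum>i<length U. c i * dv_vertex H U m i x)"
    unfolding v_eq using b_weights
    by (intro restrict_ext sum_dv_vertex[symmetric]) (auto simp: c_def tail_weights_def)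
  moreover have "(\<Sum>i<length U. c i) = 1"
    using b_weights by (simp add: c_def sum_lessThan_telescope' tail_weights_def)
  ultimately show "v \<in> dv_simplex H U m"
    using b_weights by (auto simp: dv_simplex_def c_def tail_weights_def)
qed

text \<open>Passing from \<open>m'\<close> to \<open>m\<close> multiplies the \<open>j\<close>-th tail sum by \<open>(m / m')\<^sup>j\<close>.\<close>

lemma dv_simplex_antimono:
  assumes "0 < m" and "m \<le> m'"
  shows "dv_simplex H U m' \<subseteq> dv_simplex H U m"
proof
  fix v assume "v \<in> dv_simplex H U m'"
  then obtain b where b_weights: "b 0 = 1" "b (length U) = 0" "\<And>j. j < length U \<Longrightarrow> b (Suc j) \<le> b j"
    and v_eq: "v = (\<lambda>x\<in>H. \<Sum>j<length U. b j * ((U ! j) x / real m' ^ j))"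
    by (auto simp: mem_dv_simplex_iff tail_weights_def)
  define q where "q = real m / real m'"
  have q_range: "0 \<le> q" "q \<le> 1" using assms by (simp_all add: q_def)
  have nonneg: "0 \<le> b j" if "j \<le> length U" for j
    using that
  proof (induction rule: inc_induct)
    case (step i)
    then show ?case using b_weights(3)[of i] by simp
  qed (simp add: b_weights(2))
  have "b (Suc j) * q ^ Suc j \<le> b j * q ^ j" if "j < length U" for j
    using b_weights(3)[OF that] nonneg that q_range by (intro mult_mono power_decreasing) auto
  moreover have "b j * ((U ! j) x / real m' ^ j) = b j * q ^ j * ((U ! j) x / real m ^ j)" for j x
    using assms by (simp add: q_def power_divide)
  ultimately show "v \<in> dv_simplex H U m"
    unfolding mem_dv_simplex_iff tail_weights_def v_eq using b_weights(1,2)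
    by (intro exI[of _ "\<lambda>j. b j * q ^ j"]) auto
qed

lemma dv_vertex_in_simplex:
  assumes "i < length U"
  shows "dv_vertex H U m i \<in> dv_simplex H U m"
proof -
  have "dv_vertex H U m i = (\<lambda>x\<in>H. \<Sum>k<length U. (if k = i then 1 else 0) * dv_vertex H U m k x)"
    using assms by (auto simp: if_distrib[of "\<lambda>t. t * _"] dv_vertex_def restrict_def cong: if_cong)
  then show ?thesis
    using assms unfolding dv_simplex_def
    by (intro CollectI exI[of _ "\<lambda>k. if k = i then 1 else 0"]) auto
qed

definition dv_germ :: "'x set \<Rightarrow> ('x \<Rightarrow> real) list \<Rightarrow> ('x \<Rightarrow> real) filter" where
  "dv_germ H U = (INF m\<in>{0<..}. principal (dv_simplex H U m))"

lemma eventually_dv_germ: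
  "(\<forall>\<^sub>F v in dv_germ H U. P v) \<longleftrightarrow> (\<exists>m>0. \<forall>v\<in>dv_simplex H U m. P v)"
proof -
  have "\<exists>k\<in>{0<..}. principal (dv_simplex H U k) \<le>
      inf (principal (dv_simplex H U m)) (principal (dv_simplex H U m'))"
    if "m \<in> {0<..}" "m' \<in> {0<..}" for m m' :: nat
    using that dv_simplex_antimono[of m "max m m'" H U] dv_simplex_antimono[of m' "max m m'" H U]
    by (intro bexI[of _ "max m m'"]) simp_all
  then show ?thesis
    unfolding dv_germ_def by (subst eventually_INF_base) (auto simp: eventually_principal)
qed

lemma eventually_dv_germ_sequentially:
  "(\<forall>\<^sub>F v in dv_germ H U. P v) \<longleftrightarrow> (\<forall>\<^sub>F m in sequentially. \<forall>v\<in>dv_simplex H U m. P v)"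
proof
  assume "\<forall>\<^sub>F v in dv_germ H U. P v"
  then obtain m where "m > 0" "\<forall>v\<in>dv_simplex H U m. P v" by (auto simp: eventually_dv_germ)
  then have "\<forall>v\<in>dv_simplex H U m'. P v" if "m' \<ge> m" for m'
    using dv_simplex_antimono[OF _ that, of H U] by blast
  then show "\<forall>\<^sub>F m in sequentially. \<forall>v\<in>dv_simplex H U m. P v"
    unfolding eventually_sequentially by blast
next
  assume "\<forall>\<^sub>F m in sequentially. \<forall>v\<in>dv_simplex H U m. P v"
  from eventually_happens'[OF sequentially_bot eventually_conj[OF eventually_gt_at_top[of 0] this]]
  show "\<forall>\<^sub>F v in dv_germ H U. P v" by (auto simp: eventually_dv_germ)
qed

lemma diff_val_eventually_cube: "is_diff_val H U \<Longrightarrow> \<forall>\<^sub>F v in dv_germ H U. v \<in> cube H"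
  by (simp add: is_diff_val_def eventually_dv_germ_sequentially subset_eq)

lemma truth_fun_in_dv_ideal_iff:
  assumes "vars \<phi> \<subseteq> H"
  shows "truth_fun H \<phi> \<in> dv_ideal H U \<longleftrightarrow>
    (\<forall>\<^sub>F v in dv_germ H U. v \<in> cube H \<and> luk_eval v \<phi> = 0)"
proof -
  have "truth_fun H \<phi> \<in> McN H" using assms by (auto simp: McN_def)
  then show ?thesis
    by (auto simp: dv_ideal_def eventually_dv_germ truth_fun_def subset_iff)
qed

section \<open>Domination and soundness\<close>

lemma McN_eq: "McN H = truth_fun H ` {\<phi>. vars \<phi> \<subseteq> H}"
  by (auto simp: McN_def)

lemma McN_embed_inject:
  assumes "H \<subseteq> K" and "f \<in> McN H" and "g \<in> McN H" and "McN_embed H K f = McN_embed H K g"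
  shows "f = g"
proof (rule extensionalityI)
  show "f \<in> extensional (cube H)" "g \<in> extensional (cube H)"
    using assms(2,3) by (auto simp: McN_def truth_fun_def)
  fix v assume v_in: "v \<in> cube H"
  define v' where "v' = (\<lambda>x\<in>K. if x \<in> H then v x else 0)"
  have "v' \<in> cube K" using v_in by (auto simp: cube_def PiE_iff v'_def)
  moreover have "restrict v' H = v"
    using v_in assms(1) by (auto simp: cube_def PiE_iff v'_def fun_eq_iff extensional_def)
  ultimately show "f v = g v"
    using fun_cong[OF assms(4), of v'] by (simp add: McN_embed_def)
qed

lemma McN_embed_truth_fun:
  assumes "vars \<phi> \<subseteq> H" and "H \<subseteq> K"
  shows "McN_embed H K (truth_fun H \<phi>) = truth_fun K \<phi>"
proof -
  have "restrict v H \<in> cube H" if "v \<in> cube K" for v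
    using that assms(2) by (auto simp: cube_def PiE_iff)
  moreover have "luk_eval (restrict v H) \<phi> = luk_eval v \<phi>" for v
    using assms(1) by (intro luk_eval_cong) auto
  ultimately show ?thesis
    unfolding McN_embed_def truth_fun_def by (auto intro!: restrict_ext)
qed

lemma dominates_iff:
  assumes "H \<subseteq> K"
  shows "dominates K V H U \<longleftrightarrow> (\<forall>\<phi>. vars \<phi> \<subseteq> H \<longrightarrow>
    (truth_fun H \<phi> \<in> dv_ideal H U \<longleftrightarrow> truth_fun K \<phi> \<in> dv_ideal K V))"
proof -
  have "inj_on (McN_embed H K) (McN H)"
    using McN_embed_inject[OF assms] by (auto intro: inj_onI)
  moreover have "dv_ideal H U \<subseteq> McN H" by (auto simp: dv_ideal_def)
  ultimately have "f \<in> dv_ideal H U \<longleftrightarrow> McN_embed H K f \<in> McN_embed H K ` dv_ideal H U"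
    if "f \<in> McN H" for f
    using that by (simp add: inj_on_image_mem_iff)
  then have "dominates K V H U \<longleftrightarrow>
      (\<forall>f\<in>McN H. f \<in> dv_ideal H U \<longleftrightarrow> McN_embed H K f \<in> dv_ideal K V)"
    unfolding dominates_def using \<open>dv_ideal H U \<subseteq> McN H\<close> by blast
  also have "\<dots> \<longleftrightarrow> (\<forall>\<phi>. vars \<phi> \<subseteq> H \<longrightarrow>
      (truth_fun H \<phi> \<in> dv_ideal H U \<longleftrightarrow> truth_fun K \<phi> \<in> dv_ideal K V))"
    by (simp add: McN_eq McN_embed_truth_fun[OF _ assms])
  finally show ?thesis .
qed

lemma finite_vars: "finite (vars \<phi>)"
  by (induction \<phi>) auto

lemma dv_satisfies_iff_ideal:
  "dv_satisfies W \<phi> \<longleftrightarrow> truth_fun (vars \<phi>) (Neg \<phi>) \<in> dv_ideal (vars \<phi>) (W (vars \<phi>))"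
proof -
  have "(\<lambda>v\<in>cube (vars \<phi>). 1 - truth_fun (vars \<phi>) \<phi> v) = truth_fun (vars \<phi>) (Neg \<phi>)"
    unfolding truth_fun_def by (rule restrict_ext) (simp add: mv_neg_def)
  then show ?thesis by (simp add: dv_satisfies_def)
qed

lemma diff_val_family_eventually_cube:
  assumes "is_diff_val_family X W" and "finite K" and "K \<subseteq> X"
  shows "\<forall>\<^sub>F v in dv_germ K (W K). v \<in> cube K"
  using assms by (intro diff_val_eventually_cube) (simp add: is_diff_val_family_def)

lemma dv_satisfies_iff_eventually:
  assumes family: "is_diff_val_family X W" and "finite K" and "vars \<phi> \<subseteq> K" and "K \<subseteq> X"
  shows "dv_satisfies W \<phi> \<longleftrightarrow> (\<forall>\<^sub>F v in dv_germ K (W K). luk_eval v \<phi> = 1)"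
proof -
  have "dominates (vars \<phi> \<union> K) (W (vars \<phi> \<union> K)) (vars \<phi>) (W (vars \<phi>))"
    using family assms(2-) finite_vars[of \<phi>] unfolding is_diff_val_family_def by blast
  then have "dominates K (W K) (vars \<phi>) (W (vars \<phi>))"
    using assms(3) by (simp add: Un_absorb1)
  then have "dv_satisfies W \<phi> \<longleftrightarrow> truth_fun K (Neg \<phi>) \<in> dv_ideal K (W K)"
    using assms(3) by (simp add: dv_satisfies_iff_ideal dominates_iff)
  also have "\<dots> \<longleftrightarrow> (\<forall>\<^sub>F v in dv_germ K (W K). luk_eval v \<phi> = 1)"
    using assms(3) diff_val_family_eventually_cube[OF family assms(2,4)]
    by (simp add: truth_fun_in_dv_ideal_iff eventually_conj_iff mv_neg_def)
  finally show ?thesis .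
qed

lemma luk_eval_range:
  assumes "v \<in> cube H" and "vars \<phi> \<subseteq> H"
  shows "0 \<le> luk_eval v \<phi>" and "luk_eval v \<phi> \<le> 1"
proof -
  have "luk_eval v \<phi> \<in> {0..1}"
    using assms(2)
  proof (induction \<phi>)
    case (Var x)
    then show ?case using assms(1) by (auto simp: cube_def PiE_iff)
  qed (auto simp: mv_neg_def mv_oplus_def)
  then show "0 \<le> luk_eval v \<phi>" "luk_eval v \<phi> \<le> 1" by simp_all
qed

lemma luk_eval_axiom:
  assumes "luk_axiom \<phi>" and "vars \<phi> \<subseteq> H" and "v \<in> cube H"
  shows "luk_eval v \<phi> = 1"
  using assms(1,2) by (induction rule: luk_axiom.induct)
    (use luk_eval_range[OF assms(3)] in \<open>auto simp: mv_neg_def mv_oplus_def min_def\<close>)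

lemma dv_satisfies_axiom:
  assumes "is_diff_val_family X W" and "luk_axiom \<phi>" and "vars \<phi> \<subseteq> X"
  shows "dv_satisfies W \<phi>"
proof -
  have "\<forall>\<^sub>F v in dv_germ (vars \<phi>) (W (vars \<phi>)). luk_eval v \<phi> = 1"
    using diff_val_family_eventually_cube[OF assms(1) finite_vars assms(3)]
    by eventually_elim (rule luk_eval_axiom[OF assms(2) order_refl])
  then show ?thesis
    using dv_satisfies_iff_eventually[OF assms(1) finite_vars order_refl assms(3)] by blast
qed

lemma dv_satisfies_mp:
  assumes family: "is_diff_val_family X W" and "vars (Imp \<phi> \<psi>) \<subseteq> X"
    and "dv_satisfies W \<phi>" and "dv_satisfies W (Imp \<phi> \<psi>)"
  shows "dv_satisfies W \<psi>"
proof -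
  define K where "K = vars (Imp \<phi> \<psi>)"
  have K_vars: "finite K" "K \<subseteq> X" "vars \<phi> \<subseteq> K" "vars \<psi> \<subseteq> K"
    unfolding K_def using assms(2) finite_vars by auto
  note satisfies_iff = dv_satisfies_iff_eventually[OF family K_vars(1) _ K_vars(2)]
  have "\<forall>\<^sub>F v in dv_germ K (W K). luk_eval v \<phi> = 1"
    and "\<forall>\<^sub>F v in dv_germ K (W K). luk_eval v (Imp \<phi> \<psi>) = 1"
    using assms(3,4) K_vars(3) by (simp_all only: satisfies_iff K_def order_refl)
  with diff_val_family_eventually_cube[OF family K_vars(1,2)]
  have "\<forall>\<^sub>F v in dv_germ K (W K). luk_eval v \<psi> = 1"
    by eventually_elim (use luk_eval_range[OF _ K_vars(4)] in \<open>force simp: mv_neg_def mv_oplus_def\<close>)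
  then show ?thesis using satisfies_iff[OF K_vars(4)] by simp
qed

lemma luk_derives_FORM:
  assumes "luk_derives X \<Theta> \<phi>" and "\<Theta> \<subseteq> FORM X"
  shows "\<phi> \<in> FORM X"
  using assms by (induction rule: luk_derives.induct) (auto simp: FORM_def)

theorem soundness:
  assumes "luk_derives X \<Theta> \<psi>" and "\<Theta> \<subseteq> FORM X"
  shows "dv_entails X \<Theta> \<psi>"
  unfolding dv_entails_def
proof (intro allI impI)
  fix W assume family: "is_diff_val_family X W" and satisfies: "\<forall>\<theta>\<in>\<Theta>. dv_satisfies W \<theta>"
  show "dv_satisfies W \<psi>"
    using assms(1)
  proof (induction rule: luk_derives.induct)
    case (hyp \<theta>)
    then show ?case using satisfies by simp
  next
    case (ax \<phi>)
    then show ?case using dv_satisfies_axiom[OF family] by (simp add: FORM_def)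
  next
    case (mp \<phi> \<psi>)
    have "vars (Imp \<phi> \<psi>) \<subseteq> X"
      using luk_derives_FORM[OF mp.hyps(2) assms(2)] by (simp add: FORM_def)
    then show ?case using dv_satisfies_mp[OF family] mp.IH by blast
  qed
qed

section \<open>Signs of affine forms\<close>

definition affine_form :: "'x set \<Rightarrow> (('x \<Rightarrow> real) \<Rightarrow> real) \<Rightarrow> bool" where
  "affine_form H g \<longleftrightarrow> (\<exists>c0 c. \<forall>v. g v = c0 + (\<Sum>x\<in>H. c x * v x))"

lemma affine_form_const: "affine_form H (\<lambda>v. c0)"
  unfolding affine_form_def by (intro exI[of _ c0] exI[of _ "\<lambda>x. 0"]) simp

lemma affine_form_coordinate:
  assumes "finite H" and "y \<in> H"
  shows "affine_form H (\<lambda>v. v y)"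
  unfolding affine_form_def using assms
  by (intro exI[of _ 0] exI[of _ "\<lambda>x. if x = y then 1 else 0"])
    (simp add: if_distrib[of "\<lambda>t. t * _"] cong: if_cong)

lemma affine_form_diff:
  assumes "affine_form H g" and "affine_form H h"
  shows "affine_form H (\<lambda>v. g v - h v)"
proof -
  obtain c0 c d0 d where "\<And>v. g v = c0 + (\<Sum>x\<in>H. c x * v x)" "\<And>v. h v = d0 + (\<Sum>x\<in>H. d x * v x)"
    using assms unfolding affine_form_def by blast
  then have "g v - h v = (c0 - d0) + (\<Sum>x\<in>H. (c x - d x) * v x)" for v
    by (simp add: left_diff_distrib sum_subtractf)
  then show ?thesis unfolding affine_form_def
    by (intro exI[of _ "c0 - d0"] exI[of _ "\<lambda>x. c x - d x"]) blast
qed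

lemma affine_form_minus: "affine_form H g \<Longrightarrow> affine_form H (\<lambda>v. - g v)"
  using affine_form_diff[OF affine_form_const[of H 0]] by simp

lemma affine_form_convex:
  assumes "affine_form H g" and "(\<Sum>i\<in>I. w i) = 1" and "\<And>x. x \<in> H \<Longrightarrow> v x = (\<Sum>i\<in>I. w i * y i x)"
  shows "g v = (\<Sum>i\<in>I. w i * g (y i))"
proof -
  obtain c0 c where g_eq: "\<And>v. g v = c0 + (\<Sum>x\<in>H. c x * v x)"
    using assms(1) unfolding affine_form_def by blast
  have "(\<Sum>i\<in>I. w i * g (y i)) = (\<Sum>i\<in>I. w i) * c0 + (\<Sum>i\<in>I. \<Sum>x\<in>H. c x * (w i * y i x))"
    by (simp add: g_eq distrib_left sum.distrib sum_distrib_left sum_distrib_right mult_ac)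
  also have "(\<Sum>i\<in>I. \<Sum>x\<in>H. c x * (w i * y i x)) = (\<Sum>x\<in>H. c x * v x)"
    by (subst sum.swap) (simp add: assms(3) sum_distrib_left)
  finally show ?thesis by (simp add: g_eq assms(2))
qed

lemma affine_form_expansion:
  fixes u :: "nat \<Rightarrow> 'x \<Rightarrow> real"
  assumes "affine_form H g"
  obtains d where "\<And>i t v. t 0 = 1 \<Longrightarrow> (\<And>x. x \<in> H \<Longrightarrow> v x = (\<Sum>j\<le>i. t j * u j x)) \<Longrightarrow>
    g v = (\<Sum>j\<le>i. d j * t j)"
proof -
  obtain c0 c where g_eq: "\<And>v. g v = c0 + (\<Sum>x\<in>H. c x * v x)"
    using assms unfolding affine_form_def by blast
  define d where "d j = (if j = 0 then c0 else 0) + (\<Sum>x\<in>H. c x * u j x)" for j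
  have "g v = (\<Sum>j\<le>i. d j * t j)"
    if "t 0 = 1" "\<And>x. x \<in> H \<Longrightarrow> v x = (\<Sum>j\<le>i. t j * u j x)" for i :: nat and t v
  proof -
    have "(\<Sum>x\<in>H. c x * v x) = (\<Sum>x\<in>H. \<Sum>j\<le>i. c x * u j x * t j)"
      by (intro sum.cong) (auto simp: that(2) sum_distrib_left mult_ac)
    also have "\<dots> = (\<Sum>j\<le>i. (\<Sum>x\<in>H. c x * u j x) * t j)"
      by (subst sum.swap) (simp add: sum_distrib_right)
    also have "c0 = (\<Sum>j\<le>i. (if j = 0 then c0 else 0) * t j)"
      using that(1) by (simp add: if_distrib[of "\<lambda>s. s * _"] cong: if_cong)
    ultimately show ?thesis
      by (simp add: g_eq d_def distrib_right sum.distrib)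
  qed
  then show thesis by (rule that)
qed

lemma affine_form_simplex:
  assumes "affine_form H g" and "v \<in> dv_simplex H U m"
  obtains w where "\<And>i. i < length U \<Longrightarrow> w i \<ge> 0"
    and "g v = (\<Sum>i<length U. w i * g (dv_vertex H U m i))"
proof -
  from assms(2) obtain w :: "nat \<Rightarrow> real" where "\<forall>i<length U. w i \<ge> 0" "(\<Sum>i<length U. w i) = 1"
    and "v = (\<lambda>x\<in>H. \<Sum>i<length U. w i * dv_vertex H U m i x)"
    unfolding dv_simplex_def by blast
  with affine_form_convex[OF assms(1), of w "{..<length U}" v "dv_vertex H U m"] that[of w]
  show thesis by simp
qed

lemma affine_form_eventually_nonneg:
  assumes "affine_form H g"
    and "\<And>i. i < length U \<Longrightarrow> \<forall>\<^sub>F m in sequentially. g (dv_vertex H U m i) \<ge> 0"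
  shows "\<forall>\<^sub>F v in dv_germ H U. g v \<ge> 0"
proof -
  have "\<forall>\<^sub>F m in sequentially. \<forall>i\<in>{..<length U}. g (dv_vertex H U m i) \<ge> 0"
    using assms(2) by (intro eventually_ball_finite) auto
  then have "\<forall>\<^sub>F m in sequentially. \<forall>v\<in>dv_simplex H U m. g v \<ge> 0"
  proof (rule eventually_mono, intro ballI)
    fix m v assume "\<forall>i\<in>{..<length U}. g (dv_vertex H U m i) \<ge> 0" and "v \<in> dv_simplex H U m"
    then show "g v \<ge> 0"
      by (elim affine_form_simplex[OF assms(1)]) (auto intro!: sum_nonneg)
  qed
  then show ?thesis by (simp add: eventually_dv_germ_sequentially)
qed

lemma not_eventually_zero_dv_germ:
  assumes "i < length U" and "\<forall>\<^sub>F m in sequentially. g (dv_vertex H U m i) \<noteq> 0"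
  shows "\<not> (\<forall>\<^sub>F v in dv_germ H U. g v = 0)"
proof
  assume "\<forall>\<^sub>F v in dv_germ H U. g v = 0"
  then have "\<forall>\<^sub>F m in sequentially. g (dv_vertex H U m i) = 0"
    unfolding eventually_dv_germ_sequentially
    by (rule eventually_mono) (simp add: dv_vertex_in_simplex assms(1))
  with assms(2) have "\<forall>\<^sub>F m in sequentially. False" by eventually_elim simp
  then show False by simp
qed

lemma smallo_chain:
  fixes b :: "nat \<Rightarrow> 'b \<Rightarrow> real"
  assumes "\<And>j. j < n \<Longrightarrow> b (Suc j) \<in> o[F](b j)" and "s < j" and "j \<le> n"
  shows "b j \<in> o[F](b s)"
  using assms(2,3)
proof (induction s j rule: less_Suc_induct[case_names Suc trans])
  case (Suc i)
  then show ?case using assms(1) by simp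
next
  case (trans i j k)
  then show ?case using landau_o.small_trans[of "b k" F "b j" "b i"] by simp
qed

lemma lex_sum_pos:
  fixes b :: "nat \<Rightarrow> 'b \<Rightarrow> real"
  assumes "\<And>j. j < n \<Longrightarrow> b (Suc j) \<in> o[F](b j)" and "s \<le> n"
    and "\<And>j. j < s \<Longrightarrow> d j = 0" and "d s > 0" and "\<forall>\<^sub>F k in F. b s k > 0"
  shows "\<forall>\<^sub>F k in F. (\<Sum>j\<le>n. d j * b j k) > 0"
proof -
  have split: "(\<Sum>j\<le>n. d j * b j k) = d s * b s k + (\<Sum>j\<in>{s<..n}. d j * b j k)" for k
  proof -
    have "(\<Sum>j\<le>n. d j * b j k) = (\<Sum>j\<in>insert s {s<..n}. d j * b j k)"
      using assms(2,3) by (intro sum.mono_neutral_right) auto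
    then show ?thesis by simp
  qed
  have "(\<lambda>k. \<Sum>j\<in>{s<..n}. d j * b j k) \<in> o[F](b s)"
    using assms(1) by (intro big_sum_in_smallo) (auto intro: smallo_chain)
  then have "\<forall>\<^sub>F k in F. norm (\<Sum>j\<in>{s<..n}. d j * b j k) \<le> d s / 2 * norm (b s k)"
    using assms(4) by (intro landau_o.smallD) auto
  with assms(5) show ?thesis
  proof eventually_elim
    case (elim k)
    moreover from this have "d s * b s k > 0" using assms(4) by simp
    ultimately show ?case by (simp add: split abs_if split: if_splits)
  qed
qed

lemma inverse_power_Suc_smallo: "(\<lambda>m. 1 / real m ^ Suc j) \<in> o(\<lambda>m. 1 / real m ^ j)"
proof (rule smalloI_tendsto)
  have "\<forall>\<^sub>F m in sequentially. inverse (real m) = (1 / real m ^ Suc j) / (1 / real m ^ j)"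
    using eventually_gt_at_top[of 0] by eventually_elim (simp add: field_simps)
  with lim_inverse_n show "(\<lambda>m. (1 / real m ^ Suc j) / (1 / real m ^ j)) \<longlonglongrightarrow> 0"
    by (rule Lim_transform_eventually)
  show "\<forall>\<^sub>F m in sequentially. 1 / real m ^ j \<noteq> 0"
    using eventually_gt_at_top[of 0] by eventually_elim simp
qed

lemma lex_power_sum_pos:
  assumes "s \<le> n" and "\<And>j. j < s \<Longrightarrow> d j = 0" and "d s > 0"
  shows "\<forall>\<^sub>F m in sequentially. (\<Sum>j\<le>n. d j * (1 / real m ^ j)) > 0"
proof (rule lex_sum_pos[where b = "\<lambda>j m. 1 / real m ^ j" and d = d and s = s])
  show "(\<lambda>m. 1 / real m ^ Suc j) \<in> o(\<lambda>m. 1 / real m ^ j)" for j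
    by (rule inverse_power_Suc_smallo)
  show "\<forall>\<^sub>F m in sequentially. 1 / real m ^ s > 0"
    using eventually_gt_at_top[of 0] by eventually_elim simp
qed (use assms in auto)

section \<open>The differential valuation of a sequence\<close>

locale exact_tangent_flag = tangent_flag H p n u a r "\<lambda>_ _. 0"
  for H :: "'x set" and p :: "nat \<Rightarrow> 'x \<Rightarrow> real" and n :: nat and u :: "nat \<Rightarrow> 'x \<Rightarrow> real"
    and a :: "nat \<Rightarrow> nat \<Rightarrow> real" and r :: "nat \<Rightarrow> nat" +
  assumes finite_H: "finite H" and p_cube: "p k \<in> cube H"
begin

definition U :: "('x \<Rightarrow> real) list" where
  "U = map (\<lambda>j. restrict (u j) H) [0..<Suc n]"

definition tail :: "('x \<Rightarrow> real) filter" where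
  "tail = filtermap (\<lambda>k. p (r k)) sequentially"

lemma length_U [simp]: "length U = Suc n"
  by (simp add: U_def)

lemma nth_U: "j \<le> n \<Longrightarrow> U ! j = restrict (u j) H"
  unfolding U_def by (subst nth_map) (auto simp del: upt_Suc)

lemma affine_form_coefficients:
  assumes "affine_form H g"
  obtains d where "\<And>k. g (p (r k)) = (\<Sum>j\<le>n. d j * a j k)"
    and "\<And>m i. i \<le> n \<Longrightarrow> g (dv_vertex H U m i) = (\<Sum>j\<le>i. d j * (1 / real m ^ j))"
proof -
  obtain d where d_expansion: "\<And>i t v. t 0 = 1 \<Longrightarrow> (\<And>x. x \<in> H \<Longrightarrow> v x = (\<Sum>j\<le>i. t j * u j x)) \<Longrightarrow>
      g v = (\<Sum>j\<le>i. d j * t j)"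
    using affine_form_expansion[OF assms] by blast
  show thesis
  proof (rule that)
    show "g (p (r k)) = (\<Sum>j\<le>n. d j * a j k)" for k
      by (rule d_expansion) (simp_all add: a_0 expansion)
    show "g (dv_vertex H U m i) = (\<Sum>j\<le>i. d j * (1 / real m ^ j))" if "i \<le> n" for m i
      by (rule d_expansion) (use that in \<open>auto simp: dv_vertex_def nth_U intro!: sum.cong\<close>)
  qed
qed

definition ultimately_positive :: "(('x \<Rightarrow> real) \<Rightarrow> real) \<Rightarrow> bool" where
  "ultimately_positive g \<longleftrightarrow> (\<forall>\<^sub>F v in sup (dv_germ H U) tail. g v \<ge> 0) \<and>
     \<not> (\<forall>\<^sub>F v in dv_germ H U. g v = 0) \<and> \<not> (\<forall>\<^sub>F v in tail. g v = 0)"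

lemma ultimately_positiveI:
  assumes affine_g: "affine_form H g"
    and tail_expansion: "\<And>k. g (p (r k)) = (\<Sum>j\<le>n. d j * a j k)"
    and vertex_expansion:
      "\<And>m i. i \<le> n \<Longrightarrow> g (dv_vertex H U m i) = (\<Sum>j\<le>i. d j * (1 / real m ^ j))"
    and leading: "s \<le> n" "\<And>j. j < s \<Longrightarrow> d j = 0" "d s > 0"
  shows "ultimately_positive g"
proof -
  have tail_pos: "\<forall>\<^sub>F v in tail. g v > 0"
    using lex_sum_pos[of n a sequentially s d, OF a_Suc_smallo leading] a_pos leading(1)
    by (simp add: tail_def eventually_filtermap tail_expansion)
  have "\<not> (\<forall>\<^sub>F v in tail. g v = 0)"
  proof
    assume "\<forall>\<^sub>F v in tail. g v = 0"
    with tail_pos have "\<forall>\<^sub>F v in tail. False" by eventually_elim simp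
    then show False by (simp add: tail_def eventually_filtermap)
  qed
  moreover have "\<not> (\<forall>\<^sub>F v in dv_germ H U. g v = 0)"
    using lex_power_sum_pos[of s n d, OF leading]
    by (intro not_eventually_zero_dv_germ[of n]) (auto simp: vertex_expansion elim: eventually_mono)
  moreover have "\<forall>\<^sub>F m in sequentially. g (dv_vertex H U m i) \<ge> 0" if "i \<le> n" for i
  proof (cases "s \<le> i")
    case True
    from lex_power_sum_pos[of s i d, OF this leading(2,3)] show ?thesis
      using that by (auto simp: vertex_expansion elim: eventually_mono)
  next
    case False
    then show ?thesis using that leading(2) by (simp add: vertex_expansion)
  qed
  then have "\<forall>\<^sub>F v in dv_germ H U. g v \<ge> 0"
    by (intro affine_form_eventually_nonneg[OF affine_g]) simp
  ultimately show ?thesis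
    using tail_pos by (auto simp: ultimately_positive_def eventually_sup elim: eventually_mono)
qed

text \<open>
  The sign of an affine form is that of its first nonzero coefficient along the tangent directions.
\<close>

lemma affine_form_trichotomy:
  assumes "affine_form H g"
  obtains (zero) "\<forall>\<^sub>F v in sup (dv_germ H U) tail. g v = 0"
  | (positive) "ultimately_positive g"
  | (negative) "ultimately_positive (\<lambda>v. - g v)"
proof -
  obtain d where tail_expansion: "\<And>k. g (p (r k)) = (\<Sum>j\<le>n. d j * a j k)"
    and vertex_expansion: "\<And>m i. i \<le> n \<Longrightarrow> g (dv_vertex H U m i) = (\<Sum>j\<le>i. d j * (1 / real m ^ j))"
    using affine_form_coefficients[OF assms] by blast
  show thesis
  proof (cases "\<forall>j\<le>n. d j = 0")
    case True
    have "g v = 0" if "v \<in> dv_simplex H U m" for m v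
      using that by (elim affine_form_simplex[OF assms]) (simp add: vertex_expansion True)
    then show thesis
      using True by (intro zero) (auto simp: eventually_sup eventually_dv_germ tail_def
          eventually_filtermap tail_expansion)
  next
    case False
    then obtain s where leading: "d s \<noteq> 0" "\<And>j. j < s \<Longrightarrow> d j = 0" and "s \<le> n"
      using exists_least_iff[of "\<lambda>j. d j \<noteq> 0"] by (meson leI le_less_trans less_imp_le)
    show thesis
    proof (cases "d s > 0")
      case True
      then show thesis
        using leading \<open>s \<le> n\<close> positive
          ultimately_positiveI[OF assms tail_expansion vertex_expansion] by blast
    next
      case False
      have "ultimately_positive (\<lambda>v. - g v)"
      proof (rule ultimately_positiveI)
        show "- g (p (r k)) = (\<Sum>j\<le>n. - d j * a j k)" for k
          by (simp add: tail_expansion sum_negf)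
        show "- g (dv_vertex H U m i) = (\<Sum>j\<le>i. - d j * (1 / real m ^ j))" if "i \<le> n" for m i
          using that by (simp add: vertex_expansion sum_negf)
      qed (use False leading \<open>s \<le> n\<close> affine_form_minus[OF assms] in auto)
      then show thesis by (rule negative)
    qed
  qed
qed

lemma affine_form_sign_cases:
  assumes "affine_form H g"
  obtains (nonneg) "\<forall>\<^sub>F v in sup (dv_germ H U) tail. g v \<ge> 0"
  | (nonpos) "\<forall>\<^sub>F v in sup (dv_germ H U) tail. g v \<le> 0"
  using assms
proof (cases rule: affine_form_trichotomy)
  case zero
  then show thesis by (intro nonneg) (auto elim: eventually_mono)
qed (simp_all add: ultimately_positive_def nonneg nonpos)

lemma affine_form_zero_iff:
  assumes "affine_form H g"
  shows "(\<forall>\<^sub>F v in dv_germ H U. g v = 0) \<longleftrightarrow> (\<forall>\<^sub>F v in tail. g v = 0)"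
  using assms by (cases rule: affine_form_trichotomy)
    (simp_all add: ultimately_positive_def eventually_sup)

lemma affine_form_nonneg_transfer:
  assumes affine_g: "affine_form H g" and "\<forall>\<^sub>F v in tail. g v \<ge> 0"
  shows "\<forall>\<^sub>F v in dv_germ H U. g v \<ge> 0"
  using affine_g
proof (cases rule: affine_form_sign_cases)
  case nonpos
  then have "\<forall>\<^sub>F v in tail. g v \<le> 0" by (simp add: eventually_sup)
  with assms(2) have "\<forall>\<^sub>F v in tail. g v = 0" by eventually_elim simp
  then have "\<forall>\<^sub>F v in dv_germ H U. g v = 0" using affine_form_zero_iff[OF affine_g] by simp
  then show ?thesis by eventually_elim simp
qed (simp add: eventually_sup)

lemma luk_eval_eventually_affine:
  assumes "vars \<phi> \<subseteq> H"
  shows "\<exists>g. affine_form H g \<and> (\<forall>\<^sub>F v in sup (dv_germ H U) tail. luk_eval v \<phi> = g v)"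
  using assms
proof (induction \<phi>)
  case (Var y)
  then have "affine_form H (\<lambda>v. v y)" by (simp add: affine_form_coordinate finite_H)
  then show ?case by (intro exI[of _ "\<lambda>v. v y"]) simp
next
  case (Neg \<phi>)
  then obtain g where affine_g: "affine_form H g"
    and eval_eq: "\<forall>\<^sub>F v in sup (dv_germ H U) tail. luk_eval v \<phi> = g v" by auto
  from eval_eq have "\<forall>\<^sub>F v in sup (dv_germ H U) tail. luk_eval v (Neg \<phi>) = 1 - g v"
    by eventually_elim (simp add: mv_neg_def)
  then show ?case using affine_form_diff[OF affine_form_const affine_g] by blast
next
  case (Imp \<phi> \<psi>)
  then obtain g h where affine_g: "affine_form H g" and affine_h: "affine_form H h"
    and eval_eq: "\<forall>\<^sub>F v in sup (dv_germ H U) tail. luk_eval v \<phi> = g v"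
      "\<forall>\<^sub>F v in sup (dv_germ H U) tail. luk_eval v \<psi> = h v" by auto
  from affine_form_diff[OF affine_g affine_h] show ?case
  proof (cases rule: affine_form_sign_cases)
    case nonneg
    with eval_eq have "\<forall>\<^sub>F v in sup (dv_germ H U) tail. luk_eval v (Imp \<phi> \<psi>) = 1 - (g v - h v)"
      by eventually_elim (simp add: mv_neg_def mv_oplus_def)
    then show ?thesis
      using affine_form_diff[OF affine_form_const affine_form_diff[OF affine_g affine_h]] by blast
  next
    case nonpos
    with eval_eq have "\<forall>\<^sub>F v in sup (dv_germ H U) tail. luk_eval v (Imp \<phi> \<psi>) = 1"
      by eventually_elim (simp add: mv_neg_def mv_oplus_def)
    then show ?thesis using affine_form_const by blast
  qed
qed

lemma eventually_dv_germ_cube: "\<forall>\<^sub>F v in dv_germ H U. v \<in> cube H"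
proof -
  have p_range: "0 \<le> p k y" "p k y \<le> 1" if "y \<in> H" for k y
    using p_cube[of k] that by (auto simp: cube_def PiE_iff)
  have "\<forall>\<^sub>F v in dv_germ H U. v y \<in> {0..1}" if "y \<in> H" for y
  proof -
    have coordinate: "affine_form H (\<lambda>v. v y)"
      using that by (simp add: affine_form_coordinate finite_H)
    have "\<forall>\<^sub>F v in dv_germ H U. v y \<ge> 0"
      by (rule affine_form_nonneg_transfer[OF coordinate])
        (simp add: tail_def eventually_filtermap p_range[OF that])
    moreover have "\<forall>\<^sub>F v in dv_germ H U. 1 - v y \<ge> 0"
      by (rule affine_form_nonneg_transfer[OF affine_form_diff[OF affine_form_const coordinate]])
        (simp add: tail_def eventually_filtermap p_range[OF that])
    ultimately show ?thesis by eventually_elim simp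
  qed
  then have "\<forall>\<^sub>F v in dv_germ H U. \<forall>y\<in>H. v y \<in> {0..1}"
    by (intro eventually_ball_finite finite_H) auto
  moreover have "\<forall>\<^sub>F v in dv_germ H U. v \<in> extensional H"
    by (auto simp: eventually_dv_germ dv_simplex_def)
  ultimately show ?thesis
    by eventually_elim (simp add: cube_def PiE_iff)
qed

lemma is_diff_val_U: "is_diff_val H U"
proof -
  have orthonormal_nth: "(\<Sum>x\<in>H. (U ! i) x * (U ! j) x) = (if i = j then 1 else 0)"
    if "i \<in> {1..n}" "j \<in> {1..n}" for i j
    using orthonormal_u that by (simp add: nth_U orthonormal_def dot_def)
  then have "L2_set (U ! i) H = 1" if "i \<in> {1..n}" for i
    using that by (simp add: L2_set_def power2_eq_square)
  moreover have "n \<le> card H"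
    using orthonormal_card_le[OF finite_H _ orthonormal_u] by simp
  moreover have "set U \<subseteq> H \<rightarrow>\<^sub>E UNIV" by (auto simp: U_def)
  moreover have "\<forall>\<^sub>F m in sequentially. dv_simplex H U m \<subseteq> cube H"
    using eventually_dv_germ_cube by (simp add: eventually_dv_germ_sequentially subset_eq)
  moreover have "U \<noteq> []" by (simp add: U_def)
  ultimately show ?thesis
    using orthonormal_nth by (simp add: is_diff_val_def atLeastLessThanSuc_atLeastAtMost)
qed

lemma truth_fun_in_dv_ideal_iff_tail:
  assumes "vars \<phi> \<subseteq> H"
  shows "truth_fun H \<phi> \<in> dv_ideal H U \<longleftrightarrow> (\<forall>\<^sub>F k in sequentially. luk_eval (p (r k)) \<phi> = 0)"
proof -
  obtain g where "affine_form H g" and "\<forall>\<^sub>F v in sup (dv_germ H U) tail. luk_eval v \<phi> = g v"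
    using luk_eval_eventually_affine[OF assms] by blast
  then have zero_iff: "\<forall>\<^sub>F v in dv_germ H U. luk_eval v \<phi> = 0 \<longleftrightarrow> g v = 0"
    "\<forall>\<^sub>F v in tail. luk_eval v \<phi> = 0 \<longleftrightarrow> g v = 0"
    by (auto simp: eventually_sup elim: eventually_mono)
  have "truth_fun H \<phi> \<in> dv_ideal H U \<longleftrightarrow> (\<forall>\<^sub>F v in dv_germ H U. luk_eval v \<phi> = 0)"
    using eventually_dv_germ_cube
    by (simp add: truth_fun_in_dv_ideal_iff[OF assms] eventually_conj_iff)
  also have "\<dots> \<longleftrightarrow> (\<forall>\<^sub>F v in tail. luk_eval v \<phi> = 0)"
    using eventually_subst[OF zero_iff(1)] eventually_subst[OF zero_iff(2)]
      affine_form_zero_iff[OF \<open>affine_form H g\<close>] by simp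
  finally show ?thesis by (simp add: tail_def eventually_filtermap)
qed

end

section \<open>Completeness\<close>

lemma (in prime_theory) ex_diff_val:
  assumes "finite H"
  shows "\<exists>U. is_diff_val H U \<and>
    (\<forall>\<phi>. vars \<phi> \<subseteq> H \<longrightarrow> (truth_fun H \<phi> \<in> dv_ideal H U \<longleftrightarrow> Neg \<phi> \<in> T))"
proof -
  have "\<exists>v. v \<in> cube H \<and>
      (\<forall>\<phi>. vars \<phi> \<subseteq> H \<longrightarrow> size \<phi> \<le> k \<longrightarrow> (luk_eval v \<phi> = 1 \<longleftrightarrow> \<phi> \<in> T))" for k
    by (rule ex_valuation[OF assms, of k]) blast
  then obtain p where p_cube: "\<And>k. p k \<in> cube H"
    and p_approximates: "\<And>k \<phi>. vars \<phi> \<subseteq> H \<Longrightarrow> size \<phi> \<le> k \<Longrightarrow> luk_eval (p k) \<phi> = 1 \<longleftrightarrow> \<phi> \<in> T"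
    by metis
  have "\<bar>p k x\<bar> \<le> 1" if "x \<in> H" for k x
    using p_cube[of k] that by (auto simp: cube_def PiE_iff abs_le_iff intro: order_trans[of _ 0])
  then obtain n u a r where "tangent_flag H p n u a r (\<lambda>_ _. 0)"
    using ex_exact_tangent_flag[OF assms, of p 1] by blast
  then interpret exact_tangent_flag H p n u a r
    using assms p_cube by (simp add: exact_tangent_flag_def exact_tangent_flag_axioms_def)
  have "truth_fun H \<phi> \<in> dv_ideal H U \<longleftrightarrow> Neg \<phi> \<in> T" if "vars \<phi> \<subseteq> H" for \<phi>
  proof -
    have "luk_eval (p (r k)) \<phi> = 0 \<longleftrightarrow> Neg \<phi> \<in> T" if "k \<ge> size (Neg \<phi>)" for k
      using p_approximates[of "Neg \<phi>" "r k"] \<open>vars \<phi> \<subseteq> H\<close> that seq_suble[OF strict_mono_r, of k]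
      by (simp add: mv_neg_def)
    then have "(\<forall>\<^sub>F k in sequentially. luk_eval (p (r k)) \<phi> = 0) \<longleftrightarrow>
        (\<forall>\<^sub>F k in sequentially. Neg \<phi> \<in> T)"
      by (rule eventually_cong[OF eventually_ge_at_top])
    then show ?thesis by (simp add: truth_fun_in_dv_ideal_iff_tail[OF that])
  qed
  then show ?thesis using is_diff_val_U by blast
qed

lemma (in prime_theory) ex_diff_val_family:
  obtains W where "is_diff_val_family X W" and "\<And>\<phi>. dv_satisfies W \<phi> \<longleftrightarrow> \<phi> \<in> T"
proof -
  obtain W where diff_val: "\<And>H. finite H \<Longrightarrow> is_diff_val H (W H)"
    and ideal: "\<And>H \<phi>. finite H \<Longrightarrow> vars \<phi> \<subseteq> H \<Longrightarrow>
      truth_fun H \<phi> \<in> dv_ideal H (W H) \<longleftrightarrow> Neg \<phi> \<in> T"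
    using ex_diff_val by metis
  have "dominates K (W K) H (W H)" if "finite K" "H \<subseteq> K" for H K
    using that ideal finite_subset[OF that(2,1)] by (auto simp: dominates_iff)
  then have "is_diff_val_family X W"
    using diff_val by (simp add: is_diff_val_family_def)
  moreover have "dv_satisfies W \<phi> \<longleftrightarrow> \<phi> \<in> T" for \<phi>
    using ideal[OF finite_vars, of "Neg \<phi>" \<phi>] equivalent_member_iff[OF Neg_Neg]
    by (simp add: dv_satisfies_iff_ideal)
  ultimately show thesis by (rule that)
qed

theorem completeness:
  assumes "dv_entails X \<Theta> \<psi>"
  shows "luk_derives UNIV \<Theta> \<psi>"
proof (rule ccontr)
  assume "\<not> luk_derives UNIV \<Theta> \<psi>"
  then have "\<psi> \<notin> luk_closure \<Theta>" by (simp add: luk_closure_def)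
  then obtain T where T_prime: "prime_theory T" "\<Theta> \<subseteq> T" "\<psi> \<notin> T"
    by (rule prime_theory_exists)
  obtain W where "is_diff_val_family X W" "\<And>\<phi>. dv_satisfies W \<phi> \<longleftrightarrow> \<phi> \<in> T"
    using prime_theory.ex_diff_val_family[OF T_prime(1)] by blast
  then show False using assms T_prime unfolding dv_entails_def by blast
qed

theorem theorem7p6:
  fixes X :: "'x set" and \<Theta> :: "'x luk_form set" and \<psi> :: "'x luk_form"
  assumes "infinite X" and "\<Theta> \<subseteq> FORM X" and "\<psi> \<in> FORM X"
  shows "dv_entails X \<Theta> \<psi> \<longleftrightarrow> luk_derives X \<Theta> \<psi>"
proof
  assume "luk_derives X \<Theta> \<psi>"
  then show "dv_entails X \<Theta> \<psi>" using assms(2) by (rule soundness)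
next
  assume "dv_entails X \<Theta> \<psi>"
  then have "luk_derives UNIV \<Theta> \<psi>" by (rule completeness)
  then show "luk_derives X \<Theta> \<psi>"
    by (rule luk_derives_conservative) (use assms in auto)
qed

end
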